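(* Let $\Gamma\subseteq\mathrm{SL}(2,\mathbb{Z})$ be a finitely generated Fuchsian group of the first kind with at least one parabolic class, such that $Q=\begin{pmatrix}1&\lambda\\0&1\end{pmatrix}$ ($\lambda>0$) generates the stabilizer $\Gamma_\infty$ of $\infty$. Fix generators $\{Q_0=Q,Q_1,\dots,Q_t,V_1,\dots,V_s\}$ of $\Gamma$ with $Q_0,\dots,Q_t$ parabolic and $V_1,\dots,V_s$ non-parabolic. Let $k\in\mathbb{R}$, $\chi$ a multiplier system of weight $-k$ on $\Gamma$, $\rho$ a $p$-dimensional unitary representation of $\Gamma$, and let $\{g_\gamma\}_{\gamma\in\Gamma}$ be a parabolic cocycle in $\mathcal{P}$ of weight $-k$, multiplier system $\chi$ and type $\rho$ with $g_Q=0$. For $0\le i\le t$ let $g_i\in\mathcal{P}$ satisfy $g_{Q_i}=g_i|_{-k,\chi,\rho}Q_i-g_i$. Assume there are positive constants $K,\alpha,\sigma$ with $2\sigma>-k$ and $\alpha>k$ such that $|(g_{V_i})_j(\tau)|<K(|\tau|^\alpha+v^{-\sigma})$ for $1\le i\le s$ and $|(g_i)_j(\tau)|<K(|\tau|^\alpha+v^{-\sigma})$ for $0\le i\le t$, for all $1\le j\le p$. Let $e=\max(\alpha/2,\sigma+k/2)$. Let $\mathcal{R}=\{\tau\in\mathbb{H}: |\mathrm{Re}\,\tau|<\lambda/2,\ |c\tau+d|>1 \text{ for all }\begin{pmatrix}*&*\\c&d\end{pmatrix}\in\Gamma-\Gamma_\infty\}$, fix $v_0>0$ with $iv_0\in\mathcal{R}$,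 and let $\mathcal{L}=\{\gamma\in\Gamma: -\lambda/2\le\mathrm{Re}(\gamma(iv_0))<\lambda/2\}$. For a positive even integer $r$ define \[\Phi(\tau;r)=\sum_{j=1}^p\sum_{V=\begin{pmatrix}a&b\\c&d\end{pmatrix}\in\mathcal{L}}\frac{(g_V)_j(\tau)}{(c\tau+d)^r}\mathbf{e}_j.\] If $r>2e+4$, then $\Phi(\tau;r)$ converges absolutely and uniformly on compact subsets of $\mathbb{H}$.
   Context: $\tau=u+iv\in\mathbb{H}$; real powers use a fixed standard branch. A multiplier system of weight $w$ on $\Gamma$ is $\chi:\Gamma\to\mathbb{C}$ with $|\chi|=1$, $\chi(\gamma_1\gamma_2)(c_3\tau+d_3)^w=\chi(\gamma_1)\chi(\gamma_2)(c_1\gamma_2\tau+d_1)^w(c_2\tau+d_2)^w$ and $\chi(-I)=e^{\pi iw}$. $\mathbf{e}_1,\dots,\mathbf{e}_p$ is the standard basis of $\mathbb{C}^p$. Slash operator: $(f|_{-k,\chi,\rho}\gamma)(\tau)=\chi(\gamma)^{-1}(c\tau+d)^{k}\rho(\gamma)^{-1}f(\gamma\tau)$ for $\gamma=\begin{pmatrix}a&b\\c&d\end{pmatrix}$. $\mathcal{P}$ is the space of holomorphic $G=\sum_j G_j\mathbf{e}_j:\mathbb{H}\to\mathbb{C}^p$ with $|G_j(\tau)|<K(|\tau|^{\alpha}+v^{-\sigma})$ for some positive constants $K,\alpha,\sigma$. A cocycle is a family $\{g_\gamma\}\subset\mathcal{P}$ with $g_{\gamma_1\gamma_2}=g_{\gamma_2}+g_{\gamma_1}|_{-k,\chi,\rho}\gamma_2$;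 it is parabolic if for every parabolic $B\in\Gamma$ there is $Q_B\in\mathcal{P}$ with $g_B=Q_B|_{-k,\chi,\rho}B-Q_B$. (The paper denotes the growth exponent $\alpha$ by $\rho$.) *)

theory Defs
  imports "HOL-Analysis.Analysis" "HOL-Algebra.Generated_Groups"
begin

definition SL2Z :: "(int^2^2) monoid" where
  "SL2Z = \<lparr>carrier = {A. det A = 1}, mult = (**), one = mat 1\<rparr>"

definition uhp :: "complex set" where
  "uhp = {\<tau>. Im \<tau> > 0}"

definition aut_factor :: "int^2^2 \<Rightarrow> complex \<Rightarrow> complex" where
  "aut_factor \<gamma> \<tau> = of_int (\<gamma>$2$1) * \<tau> + of_int (\<gamma>$2$2)"

definition moeb :: "int^2^2 \<Rightarrow> complex \<Rightarrow> complex" where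
  "moeb \<gamma> \<tau> = (of_int (\<gamma>$1$1) * \<tau> + of_int (\<gamma>$1$2)) / aut_factor \<gamma> \<tau>"

definition parabolic :: "int^2^2 \<Rightarrow> bool" where
  "parabolic \<gamma> \<longleftrightarrow> \<gamma> \<in> carrier SL2Z \<and> \<bar>trace \<gamma>\<bar> = 2 \<and> \<gamma> \<noteq> mat 1 \<and> \<gamma> \<noteq> - mat 1"

definition translation :: "int \<Rightarrow> int^2^2" where
  "translation l = vector [vector [1, l], vector [0, 1]]"

definition stab_inf :: "(int^2^2) set \<Rightarrow> (int^2^2) set" where
  "stab_inf \<Gamma> = {\<gamma> \<in> \<Gamma>. \<gamma>$2$1 = 0}"

text \<open>Generation as a group of transformations: \<open>-I\<close> acts trivially on the upper half-plane,
  so if it belongs to the group it is disregarded.\<close>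

definition generates_mod_sign :: "int^2^2 \<Rightarrow> (int^2^2) set \<Rightarrow> bool" where
  "generates_mod_sign A H \<longleftrightarrow> A \<in> H \<and> H \<subseteq> generate SL2Z {A, - mat 1}"

text \<open>A subgroup of \<open>SL(2,\<int>)\<close> is automatically discrete, hence Fuchsian. It is of the first kind
  if its limit set, the set of boundary points at which orbits accumulate, is all of
  \<open>\<real> \<union> {\<infinity>}\<close>; accumulation at \<open>\<infinity>\<close> means that the orbit is unbounded.\<close>

definition fuchsian_first_kind :: "(int^2^2) set \<Rightarrow> bool" where
  "fuchsian_first_kind \<Gamma> \<longleftrightarrow> subgroup \<Gamma> SL2Z
     \<and> (\<forall>x::real. \<exists>z\<in>uhp. complex_of_real x islimpt (\<lambda>\<gamma>. moeb \<gamma> z) ` \<Gamma>)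
     \<and> (\<exists>z\<in>uhp. \<not> bounded ((\<lambda>\<gamma>. moeb \<gamma> z) ` \<Gamma>))"

text \<open>Real powers with the argument normalised to \<open>[-\<pi>, \<pi>)\<close>. The library's powr on complex numbers
  uses \<open>(-\<pi>, \<pi>]\<close>, for which the conditions \<open>\<chi>(-I) = exp (\<pi> \<i> w)\<close> and
  \<open>\<chi>(I) = \<chi>(-I)\<^sup>2 ((-1) powr w)\<^sup>2\<close> would contradict each other unless \<open>2 w\<close> is an integer.\<close>

definition rpow :: "complex \<Rightarrow> real \<Rightarrow> complex" where
  "rpow z w = rcis (norm z powr w) (w * (if Arg z = pi then - pi else Arg z))"

definition multiplier_system :: "(int^2^2) set \<Rightarrow> real \<Rightarrow> (int^2^2 \<Rightarrow> complex) \<Rightarrow> bool" where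
  "multiplier_system \<Gamma> w chi \<longleftrightarrow>
     (\<forall>\<gamma>\<in>\<Gamma>. norm (chi \<gamma>) = 1) \<and>
     (\<forall>\<gamma>\<^sub>1\<in>\<Gamma>. \<forall>\<gamma>\<^sub>2\<in>\<Gamma>. \<forall>\<tau>\<in>uhp.
        chi (\<gamma>\<^sub>1 ** \<gamma>\<^sub>2) * rpow (aut_factor (\<gamma>\<^sub>1 ** \<gamma>\<^sub>2) \<tau>) w
        = chi \<gamma>\<^sub>1 * chi \<gamma>\<^sub>2 * rpow (aut_factor \<gamma>\<^sub>1 (moeb \<gamma>\<^sub>2 \<tau>)) w * rpow (aut_factor \<gamma>\<^sub>2 \<tau>) w) \<and>
     (- mat 1 \<in> \<Gamma> \<longrightarrow> chi (- mat 1) = exp (of_real (pi * w) * \<i>))"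

definition unitary_group :: "(complex^'p^'p) monoid" where
  "unitary_group = \<lparr>carrier = {A. A ** (\<chi> i j. cnj (A$j$i)) = mat 1}, mult = (**), one = mat 1\<rparr>"

definition unitary_rep :: "(int^2^2) set \<Rightarrow> (int^2^2 \<Rightarrow> complex^'p^'p) \<Rightarrow> bool" where
  "unitary_rep \<Gamma> \<rho> \<longleftrightarrow> \<rho> \<in> hom (SL2Z\<lparr>carrier := \<Gamma>\<rparr>) unitary_group"

text \<open>The weight is \<open>-k\<close>, so \<open>k\<close> is the exponent of the automorphy factor.\<close>

definition slash ::
  "real \<Rightarrow> (int^2^2 \<Rightarrow> complex) \<Rightarrow> (int^2^2 \<Rightarrow> complex^'p^'p) \<Rightarrow>
   (complex \<Rightarrow> complex^'p) \<Rightarrow> int^2^2 \<Rightarrow> complex \<Rightarrow> complex^'p" where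
  "slash k chi \<rho> f \<gamma> \<tau> =
     (inverse (chi \<gamma>) * rpow (aut_factor \<gamma> \<tau>) k) *s (matrix_inv (\<rho> \<gamma>) *v f (moeb \<gamma> \<tau>))"

definition growth_bound :: "real \<Rightarrow> real \<Rightarrow> real \<Rightarrow> (complex \<Rightarrow> complex^'p) \<Rightarrow> bool" where
  "growth_bound K \<alpha> \<sigma> G \<longleftrightarrow>
     (\<forall>j. \<forall>\<tau>\<in>uhp. norm (G \<tau> $ j) < K * (norm \<tau> powr \<alpha> + Im \<tau> powr (- \<sigma>)))"

definition space_P :: "(complex \<Rightarrow> complex^'p) set" where
  "space_P = {G. (\<forall>j. (\<lambda>\<tau>. G \<tau> $ j) holomorphic_on uhp) \<and>
                 (\<exists>K>0. \<exists>\<alpha>>0. \<exists>\<sigma>>0. growth_bound K \<alpha> \<sigma> G)}"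

definition cocycle ::
  "(int^2^2) set \<Rightarrow> real \<Rightarrow> (int^2^2 \<Rightarrow> complex) \<Rightarrow> (int^2^2 \<Rightarrow> complex^'p^'p) \<Rightarrow>
   (int^2^2 \<Rightarrow> complex \<Rightarrow> complex^'p) \<Rightarrow> bool" where
  "cocycle \<Gamma> k chi \<rho> g \<longleftrightarrow>
     (\<forall>\<gamma>\<in>\<Gamma>. g \<gamma> \<in> space_P) \<and>
     (\<forall>\<gamma>\<^sub>1\<in>\<Gamma>. \<forall>\<gamma>\<^sub>2\<in>\<Gamma>. \<forall>\<tau>\<in>uhp.
        g (\<gamma>\<^sub>1 ** \<gamma>\<^sub>2) \<tau> = g \<gamma>\<^sub>2 \<tau> + slash k chi \<rho> (g \<gamma>\<^sub>1) \<gamma>\<^sub>2 \<tau>)"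

definition parabolic_cocycle ::
  "(int^2^2) set \<Rightarrow> real \<Rightarrow> (int^2^2 \<Rightarrow> complex) \<Rightarrow> (int^2^2 \<Rightarrow> complex^'p^'p) \<Rightarrow>
   (int^2^2 \<Rightarrow> complex \<Rightarrow> complex^'p) \<Rightarrow> bool" where
  "parabolic_cocycle \<Gamma> k chi \<rho> g \<longleftrightarrow> cocycle \<Gamma> k chi \<rho> g \<and>
     (\<forall>B\<in>\<Gamma>. parabolic B \<longrightarrow>
        (\<exists>G\<in>space_P. \<forall>\<tau>\<in>uhp. g B \<tau> = slash k chi \<rho> G B \<tau> - G \<tau>))"

definition fund_region :: "(int^2^2) set \<Rightarrow> real \<Rightarrow> complex set" where
  "fund_region \<Gamma> l = {\<tau>\<in>uhp. \<bar>Re \<tau>\<bar> < l / 2 \<and>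
     (\<forall>\<gamma> \<in> \<Gamma> - stab_inf \<Gamma>. norm (aut_factor \<gamma> \<tau>) > 1)}"

definition coset_reps :: "(int^2^2) set \<Rightarrow> real \<Rightarrow> real \<Rightarrow> (int^2^2) set" where
  "coset_reps \<Gamma> l v\<^sub>0 = {\<gamma>\<in>\<Gamma>. - l / 2 \<le> Re (moeb \<gamma> (\<i> * of_real v\<^sub>0)) \<and>
                            Re (moeb \<gamma> (\<i> * of_real v\<^sub>0)) < l / 2}"

definition Phi_term ::
  "(int^2^2 \<Rightarrow> complex \<Rightarrow> complex^'p) \<Rightarrow> nat \<Rightarrow> complex \<Rightarrow> 'p \<Rightarrow> int^2^2 \<Rightarrow> complex" where
  "Phi_term g r \<tau> j V = (g V \<tau> $ j) / aut_factor V \<tau> ^ r"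

definition Phi_partial ::
  "(int^2^2 \<Rightarrow> complex \<Rightarrow> complex^'p) \<Rightarrow> nat \<Rightarrow> (int^2^2) set \<Rightarrow> complex \<Rightarrow> complex^'p" where
  "Phi_partial g r X \<tau> = (\<Sum>j\<in>UNIV. (\<Sum>V\<in>X. Phi_term g r \<tau> j V) *s axis j 1)"

definition Phi ::
  "(int^2^2 \<Rightarrow> complex \<Rightarrow> complex^'p) \<Rightarrow> (int^2^2) set \<Rightarrow> complex \<Rightarrow> nat \<Rightarrow> complex^'p" where
  "Phi g L \<tau> r = (\<Sum>j\<in>UNIV. (\<Sum>\<^sub>\<infinity>V\<in>L. Phi_term g r \<tau> j V) *s axis j 1)"

end

theory Submission
  imports Defs
begin

text \<open>The cocycle satisfies \<open>|g V \<tau>| \<le> B \<parallel>V\<parallel>\<^bsup>2e+1\<^esup>\<close> for all \<open>V \<in> \<Gamma>\<close>, uniformly on compact sets of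
  \<open>\<tau>\<close>, where \<open>\<parallel>V\<parallel>\<close> is the sum of the absolute values of the entries; the coset representatives
  satisfy \<open>\<parallel>V\<parallel> \<le> D (|c| + |d|)\<close>, so the series is dominated by the sum of
  \<open>(|c| + |d|)\<^bsup>2e+1-r\<^esup>\<close>.

  For each fixed \<open>f \<in> \<Gamma>\<close> the hypotheses give \<open>|(g f | W) \<tau>| \<le> B \<parallel>W\<parallel>\<^bsup>2e\<^esup>\<close> for all \<open>W \<in> \<Gamma>\<close>. It
  therefore suffices to write \<open>V\<close> as a product of at most \<open>\<parallel>V\<parallel>\<close> factors from a finite subset of
  \<open>\<Gamma>\<close> such that all tails of the product have norm at most a constant times \<open>\<parallel>V\<parallel>\<close>. Up to finitely
  many factors, the inverse of \<open>V\<close> is a product of the matrices \<open>(1 1; 0 1)\<close> and \<open>(1 0; 1 1)\<close>, that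
  is, a descending path in the Stern-Brocot tree. A path from \<open>1\<close> to this inverse in the given
  generators of \<open>\<Gamma>\<close> has to jump over every Farey edge \<open>M{0, \<infinity>}\<close> met by the descending path, and a
  single generator jumps over only finitely many edges. Hence each \<open>M\<close> on the descending path lies
  within bounded distance of \<open>\<Gamma>\<close>, and the nearby elements of \<open>\<Gamma>\<close> yield the factorization.\<close>

section \<open>Factorizations in subgroups of SL(2,Z)\<close>

definition mat2 :: "int \<Rightarrow> int \<Rightarrow> int \<Rightarrow> int \<Rightarrow> int^2^2" where
  "mat2 a b c d = vector [vector [a, b], vector [c, d]]"

lemma mat2_nth [simp]:
  "mat2 a b c d $ 1 $ 1 = a" "mat2 a b c d $ 1 $ 2 = b"
  "mat2 a b c d $ 2 $ 1 = c" "mat2 a b c d $ 2 $ 2 = d"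
  by (simp_all add: mat2_def)

lemma mat2_eq_iff: "(A :: int^2^2) = B \<longleftrightarrow>
    A$1$1 = B$1$1 \<and> A$1$2 = B$1$2 \<and> A$2$1 = B$2$1 \<and> A$2$2 = B$2$2"
  by (auto simp: vec_eq_iff forall_2)

lemma mult2_nth: "((A :: int^2^2) ** B) $ i $ j = A$i$1 * B$1$j + A$i$2 * B$2$j"
  by (simp add: matrix_matrix_mult_def sum_2)

lemma mat_1_nth [simp]:
  "(mat 1 :: int^2^2) $ 1 $ 1 = 1" "(mat 1 :: int^2^2) $ 1 $ 2 = 0"
  "(mat 1 :: int^2^2) $ 2 $ 1 = 0" "(mat 1 :: int^2^2) $ 2 $ 2 = 1"
  by (simp_all add: mat_def)

definition SL2 :: "(int^2^2) set" where
  "SL2 = {A. A$1$1 * A$2$2 - A$1$2 * A$2$1 = 1}"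

lemma carrier_SL2Z: "carrier SL2Z = SL2"
  by (auto simp: SL2Z_def SL2_def det_2)

lemma SL2Z_mult [simp]: "x \<otimes>\<^bsub>SL2Z\<^esub> y = x ** y"
  and SL2Z_one [simp]: "\<one>\<^bsub>SL2Z\<^esub> = mat 1"
  by (simp_all add: SL2Z_def)

text \<open>The adjugate, which is the inverse in determinant 1. Its entries are explicit, so
  inverses stay integral and identities between them unfold to polynomial ones.\<close>

definition adj2 :: "int^2^2 \<Rightarrow> int^2^2" where
  "adj2 A = mat2 (A$2$2) (- (A$1$2)) (- (A$2$1)) (A$1$1)"

lemma adj2_nth [simp]:
  "adj2 A $ 1 $ 1 = A$2$2" "adj2 A $ 1 $ 2 = - (A$1$2)"
  "adj2 A $ 2 $ 1 = - (A$2$1)" "adj2 A $ 2 $ 2 = A$1$1"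
  by (simp_all add: adj2_def)

lemma SL2_one [simp]: "mat 1 \<in> SL2"
  by (simp add: SL2_def)

lemma SL2_mult: "A \<in> SL2 \<Longrightarrow> B \<in> SL2 \<Longrightarrow> A ** B \<in> SL2"
  using det_mul[of A B] by (simp add: SL2_def flip: det_2)

lemma SL2_adj2: "A \<in> SL2 \<Longrightarrow> adj2 A \<in> SL2"
  by (simp add: SL2_def algebra_simps)

lemma adj2_mult: "adj2 (A ** B) = adj2 B ** adj2 A"
  by (simp add: mat2_eq_iff mult2_nth algebra_simps)

lemma adj2_adj2 [simp]: "adj2 (adj2 A) = A"
  by (simp add: mat2_eq_iff)

lemma adj2_left: "A \<in> SL2 \<Longrightarrow> adj2 A ** A = mat 1"
  and adj2_right: "A \<in> SL2 \<Longrightarrow> A ** adj2 A = mat 1"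
  by (simp_all add: SL2_def mat2_eq_iff mult2_nth algebra_simps)

lemma group_SL2Z: "group SL2Z"
proof (rule groupI)
  fix x assume "x \<in> carrier SL2Z"
  then show "\<exists>y\<in>carrier SL2Z. y \<otimes>\<^bsub>SL2Z\<^esub> x = \<one>\<^bsub>SL2Z\<^esub>"
    using adj2_left SL2_adj2 by (auto simp: carrier_SL2Z)
qed (auto simp: carrier_SL2Z SL2_mult matrix_mul_assoc)

lemma SL2Z_inv: "A \<in> SL2 \<Longrightarrow> inv\<^bsub>SL2Z\<^esub> A = adj2 A"
  by (rule group.inv_equality[OF group_SL2Z]) (auto simp: carrier_SL2Z SL2_adj2 adj2_left)

section \<open>The size of a matrix\<close>

text \<open>This is the norm \<open>\<parallel>V\<parallel>\<close> in which all growth is measured: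
  it is submultiplicative, invariant under inversion, and has finite balls on integral
  matrices.\<close>

definition entry_sum :: "int^2^2 \<Rightarrow> int" where
  "entry_sum A = \<bar>A$1$1\<bar> + \<bar>A$1$2\<bar> + \<bar>A$2$1\<bar> + \<bar>A$2$2\<bar>"

lemma entry_sum_adj2 [simp]: "entry_sum (adj2 A) = entry_sum A"
  by (simp add: entry_sum_def)

lemma entry_sum_nonneg: "entry_sum A \<ge> 0"
  by (simp add: entry_sum_def)

lemma entry_sum_mult: "entry_sum (A ** B) \<le> entry_sum A * entry_sum B"
proof -
  have *: "\<bar>x * y + z * w\<bar> \<le> \<bar>x\<bar> * \<bar>y\<bar> + \<bar>z\<bar> * \<bar>w\<bar>" for x y z w :: int
    using abs_triangle_ineq[of "x * y" "z * w"] by (simp add: abs_mult)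
  have "entry_sum (A ** B) \<le>
      (\<bar>A$1$1\<bar> * \<bar>B$1$1\<bar> + \<bar>A$1$2\<bar> * \<bar>B$2$1\<bar>) + (\<bar>A$1$1\<bar> * \<bar>B$1$2\<bar> + \<bar>A$1$2\<bar> * \<bar>B$2$2\<bar>)
    + (\<bar>A$2$1\<bar> * \<bar>B$1$1\<bar> + \<bar>A$2$2\<bar> * \<bar>B$2$1\<bar>) + (\<bar>A$2$1\<bar> * \<bar>B$1$2\<bar> + \<bar>A$2$2\<bar> * \<bar>B$2$2\<bar>)"
    unfolding entry_sum_def mult2_nth by (intro add_mono *)
  also have "\<dots> \<le> entry_sum A * entry_sum B"
    unfolding entry_sum_def by (simp add: distrib_left distrib_right)
  finally show ?thesis .
qed

lemma SL2_row_nonzero: "A \<in> SL2 \<Longrightarrow> A$k$1 \<noteq> 0 \<or> A$k$2 \<noteq> 0"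
  using exhaust_2[of k] by (auto simp: SL2_def)

lemma entry_sum_ge_1: "A \<in> SL2 \<Longrightarrow> entry_sum A \<ge> 1"
  using SL2_row_nonzero[of A 1] by (auto simp: entry_sum_def)

lemma finite_entries_bounded: "finite {A :: int^2^2. \<forall>i j. \<bar>A$i$j\<bar> \<le> n}"
proof (rule finite_subset)
  show "{A :: int^2^2. \<forall>i j. \<bar>A$i$j\<bar> \<le> n} \<subseteq>
      (\<lambda>(a, b, c, d). mat2 a b c d) ` ({-n..n} \<times> {-n..n} \<times> {-n..n} \<times> {-n..n})"
  proof
    fix A :: "int^2^2" assume "A \<in> {A. \<forall>i j. \<bar>A$i$j\<bar> \<le> n}"
    then have "\<bar>A$i$j\<bar> \<le> n" for i j by blast
    then have "A$i$j \<in> {-n..n}" for i j using abs_le_iff[of "A$i$j" n] by auto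
    moreover have "A = mat2 (A$1$1) (A$1$2) (A$2$1) (A$2$2)"
      by (simp add: mat2_eq_iff)
    ultimately show "A \<in> (\<lambda>(a, b, c, d). mat2 a b c d) ` ({-n..n} \<times> {-n..n} \<times> {-n..n} \<times> {-n..n})"
      by (intro image_eqI[of _ _ "(A$1$1, A$1$2, A$2$1, A$2$2)"]) auto
  qed
qed auto

section \<open>Farey edges crossed by a path of generators\<close>

text \<open>\<open>cols_agree (adj2 M ** x)\<close> says that the Farey edge \<open>x{0, \<infinity>}\<close> lies inside the closed interval
  \<open>M[0, \<infinity>]\<close>, and \<open>cols_oppose (adj2 M ** x)\<close> that it lies outside its interior.\<close>

definition cols_agree :: "int^2^2 \<Rightarrow> bool" where
  "cols_agree A \<longleftrightarrow> A$1$1 * A$2$1 \<ge> 0 \<and> A$1$2 * A$2$2 \<ge> 0"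

definition cols_oppose :: "int^2^2 \<Rightarrow> bool" where
  "cols_oppose A \<longleftrightarrow> A$1$1 * A$2$1 \<le> 0 \<and> A$1$2 * A$2$2 \<le> 0"

text \<open>The products \<open>a * d\<close> and \<open>b * c\<close> are consecutive integers, so
  their product is nonnegative, whereas it equals \<open>(a * c) * (b * d)\<close>, which would be
  negative.\<close>

lemma det_1_not_mixed:
  fixes a b c d :: int
  assumes "a * d - b * c = 1" "a * c > 0" "b * d < 0"
  shows False
proof -
  have "(a * d) * (b * c) < 0"
    using mult_pos_neg[OF assms(2,3)] by (simp add: ac_simps)
  moreover have "a * d = b * c + 1" using assms(1) by simp
  ultimately have "(b * c + 1) * (b * c) < 0" by simp
  then show False by (smt (verit) mult_nonneg_nonneg mult_nonpos_nonpos)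
qed

text \<open>Two Farey edges never cross, so each edge lies on one side of the other. Algebraically,
  columns of mixed type are excluded by determinant 1.\<close>

lemma cols_agree_or_oppose:
  assumes "A \<in> SL2"
  shows "cols_agree A \<or> cols_oppose A"
proof (rule ccontr)
  assume "\<not> ?thesis"
  then consider "A$1$1 * A$2$1 > 0" "A$1$2 * A$2$2 < 0" | "A$1$1 * A$2$1 < 0" "A$1$2 * A$2$2 > 0"
    unfolding cols_agree_def cols_oppose_def by linarith
  then show False
  proof cases
    case 1
    then show False using det_1_not_mixed[of "A$1$1" "A$2$2" "A$1$2" "A$2$1"] assms by (simp add: SL2_def)
  next
    case 2
    then show False using det_1_not_mixed[of "A$1$2" "-(A$2$1)" "A$1$1" "-(A$2$2)"] assms
      by (smt (verit) SL2_def det_1_not_mixed mem_Collect_eq mult.commute mult_minus_right)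
  qed
qed

lemma abs_sum_products:
  fixes a b x y :: int
  assumes "a * b \<ge> 0" "x * y \<ge> 0"
  shows "\<bar>a * x + b * y\<bar> = \<bar>a\<bar> * \<bar>x\<bar> + \<bar>b\<bar> * \<bar>y\<bar>"
proof -
  have "(a * x) * (b * y) \<ge> 0"
    using mult_nonneg_nonneg[OF assms] by (simp add: ac_simps)
  then have "\<bar>a * x + b * y\<bar> = \<bar>a * x\<bar> + \<bar>b * y\<bar>"
    by (smt (verit) mult_neg_pos mult_pos_neg)
  then show ?thesis by (simp add: abs_mult)
qed

text \<open>In the product \<open>s = adj2 y ** (y ** s)\<close> no cancellation occurs, so the entries of \<open>s\<close>
  bound those of \<open>y\<close>.\<close>

lemma finite_cols_switch:
  assumes "s \<in> SL2"
  shows "finite {y \<in> SL2. cols_oppose y \<and> cols_agree (y ** s)}"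
proof (rule finite_subset)
  show "{y \<in> SL2. cols_oppose y \<and> cols_agree (y ** s)} \<subseteq> {y. \<forall>i j. \<bar>y$i$j\<bar> \<le> entry_sum s}"
  proof
    fix y assume "y \<in> {y \<in> SL2. cols_oppose y \<and> cols_agree (y ** s)}"
    then have y: "y \<in> SL2" "cols_oppose y" "cols_agree (y ** s)" by auto
    define u z where "u = y ** s" and "z = adj2 y"
    have u: "u \<in> SL2" using y(1) assms by (simp add: u_def SL2_mult)
    have s: "s = z ** u" using y(1) by (simp add: u_def z_def matrix_mul_assoc adj2_left)
    have rows: "z$i$1 * z$i$2 \<ge> 0" for i
      using y(2) exhaust_2[of i] by (auto simp: z_def cols_oppose_def ac_simps)
    have cols: "u$1$j * u$2$j \<ge> 0" for j
      using y(3) exhaust_2[of j] by (auto simp: u_def cols_agree_def)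
    have eq: "\<bar>s$i$j\<bar> = \<bar>z$i$1\<bar> * \<bar>u$1$j\<bar> + \<bar>z$i$2\<bar> * \<bar>u$2$j\<bar>" for i j
      unfolding s mult2_nth by (rule abs_sum_products[OF rows cols])
    have row: "\<bar>s$i$1\<bar> + \<bar>s$i$2\<bar> =
        \<bar>z$i$1\<bar> * (\<bar>u$1$1\<bar> + \<bar>u$1$2\<bar>) + \<bar>z$i$2\<bar> * (\<bar>u$2$1\<bar> + \<bar>u$2$2\<bar>)" for i
      unfolding eq by (simp add: algebra_simps)
    have pos: "\<bar>u$k$1\<bar> + \<bar>u$k$2\<bar> \<ge> 1" for k
      using SL2_row_nonzero[OF u, of k] by linarith
    have le: "\<bar>z$i$k\<bar> \<le> \<bar>s$i$1\<bar> + \<bar>s$i$2\<bar>" for i k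
    proof -
      have "\<bar>z$i$k\<bar> \<le> \<bar>z$i$k\<bar> * (\<bar>u$k$1\<bar> + \<bar>u$k$2\<bar>)" for k
        using mult_left_mono[OF pos[of k], of "\<bar>z$i$k\<bar>"] by simp
      from this[of 1] this[of 2] show ?thesis
        using row[of i] exhaust_2[of k] by (smt (verit) abs_ge_zero)
    qed
    have "\<bar>z$i$k\<bar> \<le> entry_sum s" for i k
      using le[of i k] exhaust_2[of i] by (auto simp: entry_sum_def)
    from this[of 1 1] this[of 1 2] this[of 2 1] this[of 2 2]
    show "y \<in> {y. \<forall>i j. \<bar>y$i$j\<bar> \<le> entry_sum s}"
      by (simp add: z_def forall_2)
  qed
qed (rule finite_entries_bounded)

text \<open>A discrete intermediate value argument: the word \<open>h\<close> leads from the
  opposing to the agreeing side, so some single letter \<open>s\<close> makes the change. For a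
  product \<open>h1 ** h2\<close> the change happens within \<open>h1\<close>, or
  \<open>Y ** h1\<close> still opposes and serves as the new starting point for \<open>h2\<close>.
  The letter \<open>mat 1\<close> covers the empty word, where \<open>Y\<close> is of both types at
  once.\<close>

lemma cols_switch_on_path:
  assumes "h \<in> generate SL2Z S" "S \<subseteq> SL2" "Y \<in> SL2" "cols_oppose Y" "cols_agree (Y ** h)"
  shows "\<exists>x\<in>generate SL2Z S. \<exists>s\<in>insert (mat 1) (S \<union> adj2 ` S).
           cols_oppose (Y ** x) \<and> cols_agree (Y ** x ** s)"
  using assms(1,3-)
proof (induction arbitrary: Y rule: generate.induct)
  case one
  then show ?case by (intro bexI[of _ "mat 1"]) (use generate.one[of SL2Z S] in auto)
next
  case (incl h)
  then show ?case by (intro bexI[of _ "mat 1"] bexI[of _ h]) (use generate.one[of SL2Z S] in auto)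
next
  case (inv h)
  then have "inv\<^bsub>SL2Z\<^esub> h = adj2 h" using assms(2) SL2Z_inv by blast
  with inv show ?case
    by (intro bexI[of _ "mat 1"] bexI[of _ "adj2 h"]) (use generate.one[of SL2Z S] in auto)
next
  case (eng h1 h2)
  have SL2: "generate SL2Z S \<subseteq> SL2"
    using group.generate_incl[OF group_SL2Z] assms(2) by (simp add: carrier_SL2Z)
  show ?case
  proof (cases "cols_agree (Y ** h1)")
    case True
    then show ?thesis using eng by blast
  next
    case False
    have Yh1: "Y ** h1 \<in> SL2" using eng SL2 by (blast intro: SL2_mult)
    then have "cols_oppose (Y ** h1)" using cols_agree_or_oppose False by blast
    moreover have agree: "cols_agree (Y ** h1 ** h2)"
      using eng.prems by (simp add: matrix_mul_assoc)
    ultimately obtain x s where "x \<in> generate SL2Z S" "s \<in> insert (mat 1) (S \<union> adj2 ` S)"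
      "cols_oppose (Y ** h1 ** x)" "cols_agree (Y ** h1 ** x ** s)"
      using eng.IH(2)[OF Yh1 _ agree] by blast
    then show ?thesis
      using generate.eng[OF eng.hyps(1), of x] by (intro bexI[of _ "h1 ** x"] bexI[of _ s]) (auto simp: matrix_mul_assoc)
  qed
qed

section \<open>Descent in the Stern-Brocot tree\<close>

definition nonneg_mat :: "int^2^2 \<Rightarrow> bool" where
  "nonneg_mat A \<longleftrightarrow> (\<forall>i j. A$i$j \<ge> 0)"

lemma nonneg_mat_iff: "nonneg_mat A \<longleftrightarrow> A$1$1 \<ge> 0 \<and> A$1$2 \<ge> 0 \<and> A$2$1 \<ge> 0 \<and> A$2$2 \<ge> 0"
  by (auto simp: nonneg_mat_def forall_2)

text \<open>One step of the Euclidean algorithm on columns, from a node of the tree to its parent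
  \<open>M'\<close>. Unless \<open>M\<close> is the identity, one column dominates the other
  entrywise; subtracting the smaller, which is nonzero, lowers the entry sum by at least 1.\<close>

lemma nonneg_mat_cases:
  assumes "M \<in> SL2" "nonneg_mat M"
  obtains "M = mat 1"
  | M' T where "M' \<in> SL2" "nonneg_mat M'" "T \<in> {mat2 1 1 0 1, mat2 1 0 1 1}" "M = M' ** T"
      "entry_sum M' + 1 \<le> entry_sum M"
proof -
  obtain a b c d where M: "M = mat2 a b c d"
    by (metis mat2_eq_iff mat2_nth)
  have nn: "a \<ge> 0" "b \<ge> 0" "c \<ge> 0" "d \<ge> 0" and det: "a * d - b * c = 1"
    using assms by (auto simp: M nonneg_mat_iff SL2_def)
  consider "a \<le> b" "c \<le> d" | "b \<le> a" "d \<le> c" | "b < a" "c < d" | "a < b" "d < c" by linarith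
  then show thesis
  proof cases
    case 1
    have "a \<noteq> 0 \<or> c \<noteq> 0" using det by auto
    then have "a + c \<ge> 1" using nn by linarith
    show thesis
      by (rule that(2)[of "mat2 a (b - a) c (d - c)" "mat2 1 1 0 1"])
         (use 1 nn det \<open>a + c \<ge> 1\<close> in \<open>auto simp: M SL2_def nonneg_mat_iff mat2_eq_iff mult2_nth entry_sum_def algebra_simps\<close>)
  next
    case 2
    have "b \<noteq> 0 \<or> d \<noteq> 0" using det by auto
    then have "b + d \<ge> 1" using nn by linarith
    show thesis
      by (rule that(2)[of "mat2 (a - b) b (c - d) d" "mat2 1 0 1 1"])
         (use 2 nn det \<open>b + d \<ge> 1\<close> in \<open>auto simp: M SL2_def nonneg_mat_iff mat2_eq_iff mult2_nth entry_sum_def algebra_simps\<close>)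
  next
    case 3
    \<comment> \<open>If neither column dominates and the diagonal is the larger, then
      \<open>b * c + 1 = a * d\<close> is at least \<open>(b + 1) * (c + 1)\<close>, which leaves
      only the identity.\<close>
    have "(b + 1) * (c + 1) \<le> a * d" using 3 nn by (intro mult_mono) auto
    then have "b + c \<le> 0" using det by (simp add: algebra_simps)
    then have "b = 0" "c = 0" using nn by auto
    then have "a = 1" "d = 1" using det nn by (auto simp: zmult_eq_1_iff)
    then show thesis using that(1) \<open>b = 0\<close> \<open>c = 0\<close> by (simp add: M mat2_eq_iff)
  next
    case 4
    have "a * d \<le> b * c" using 4 nn by (intro mult_mono) auto
    then show thesis using det by simp
  qed
qed

text \<open>The interval \<open>M[0, \<infinity>]\<close> is contained in
  \<open>[0, \<infinity>]\<close>, so the edge \<open>{0, \<infinity>}\<close> of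
  \<open>x = mat 1\<close> is not in its interior. Hence a path starting at the identity starts on
  the opposing side.\<close>

lemma cols_oppose_adj2_nonneg:
  "nonneg_mat M \<Longrightarrow> cols_oppose (adj2 M)"
  by (simp add: nonneg_mat_iff cols_oppose_def mult_nonneg_nonneg)

lemma nonneg_sum_product:
  fixes p q u w x y :: int
  assumes "p \<ge> 0" "q \<ge> 0" "u \<ge> 0" "w \<ge> 0" "x * y \<ge> 0"
  shows "(p * x + q * y) * (u * x + w * y) \<ge> 0"
proof -
  have "(p * x + q * y) * (u * x + w * y) = (p * u) * (x * x) + (p * w + q * u) * (x * y) + (q * w) * (y * y)"
    by (simp add: algebra_simps)
  also have "\<dots> \<ge> 0" using assms zero_le_square[of x] zero_le_square[of y]
    by (intro add_nonneg_nonneg mult_nonneg_nonneg[of "_ * _" "_ * _"]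
        mult_nonneg_nonneg[of "_ + _"] mult_nonneg_nonneg[of p] mult_nonneg_nonneg[of q])
  finally show ?thesis .
qed

text \<open>For \<open>M = M' ** T\<close> this passes from the interval of \<open>M\<close> to the
  larger interval of its parent \<open>M'\<close>, since
  \<open>adj2 M' = T ** adj2 M\<close>.\<close>

lemma cols_agree_nonneg_mult:
  assumes "nonneg_mat T" "cols_agree A"
  shows "cols_agree (T ** A)"
  using assms unfolding cols_agree_def nonneg_mat_iff mult2_nth by (auto intro!: nonneg_sum_product)

text \<open>The rotation \<open>\<tau> \<mapsto> -1/\<tau>\<close>. On the right it permutes columns
  up to sign and so preserves the edge; on the left it negates the product of the two entries in
  each column and so exchanges agreement and opposition.\<close>

definition S2 :: "int^2^2" where "S2 = mat2 0 (-1) 1 0"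

lemma S2_SL2 [simp]: "S2 \<in> SL2"
  by (simp add: S2_def SL2_def)

lemma cols_oppose_mult_S2: "cols_oppose (A ** S2) \<longleftrightarrow> cols_oppose A"
  by (auto simp: cols_oppose_def mult2_nth S2_def)

lemma cols_agree_S2_mult: "cols_agree (S2 ** A) \<longleftrightarrow> cols_oppose A"
  by (auto simp: cols_oppose_def cols_agree_def mult2_nth S2_def algebra_simps)

lemma entry_sum_S2_mult: "entry_sum (S2 ** A) = entry_sum A"
  by (simp add: entry_sum_def mult2_nth S2_def)

text \<open>Each column of \<open>A\<close> has entries of one sign. Taking absolute values, and
  exchanging the columns when their signs differ so that the determinant stays 1, gives
  \<open>M\<close>. The remaining \<open>y\<close> fixes the edge \<open>{0, \<infinity>}\<close>,
  so it is of both types.\<close>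

lemma cols_agree_factor:
  assumes "A \<in> SL2" "cols_agree A"
  obtains M y where "M \<in> SL2" "nonneg_mat M" "y \<in> SL2" "cols_agree y" "cols_oppose y" "A = M ** y"
    "entry_sum M = entry_sum A"
proof -
  obtain a b c d where A: "A = mat2 a b c d"
    by (metis mat2_eq_iff mat2_nth)
  have det: "a * d - b * c = 1" and ag: "a * c \<ge> 0" "b * d \<ge> 0"
    using assms by (auto simp: A SL2_def cols_agree_def)
  define M1 where "M1 = mat2 (abs a) (abs b) (abs c) (abs d)"
  define M2 where "M2 = mat2 (abs b) (abs a) (abs d) (abs c)"
  have *: "(a \<ge> 0 \<and> c \<ge> 0) \<or> (a \<le> 0 \<and> c \<le> 0)" "(b \<ge> 0 \<and> d \<ge> 0) \<or> (b \<le> 0 \<and> d \<le> 0)"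
    using ag by (auto simp: zero_le_mult_iff)
  then consider "a \<ge> 0" "c \<ge> 0" "b \<ge> 0" "d \<ge> 0" | "a \<le> 0" "c \<le> 0" "b \<le> 0" "d \<le> 0"
    | "a \<ge> 0" "c \<ge> 0" "b \<le> 0" "d \<le> 0" | "a \<le> 0" "c \<le> 0" "b \<ge> 0" "d \<ge> 0" by blast
  then show thesis
  proof cases
    case 1
    show thesis
      by (rule that[of M1 "mat 1"])
        (use 1 det in \<open>auto simp: A M1_def SL2_def nonneg_mat_iff cols_agree_def cols_oppose_def mat2_eq_iff mult2_nth entry_sum_def\<close>)
  next
    case 2
    show thesis
      by (rule that[of M1 "mat2 (-1) 0 0 (-1)"])
        (use 2 det in \<open>auto simp: A M1_def SL2_def nonneg_mat_iff cols_agree_def cols_oppose_def mat2_eq_iff mult2_nth entry_sum_def\<close>)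
  next
    case 3
    show thesis
      by (rule that[of M2 "mat2 0 (-1) 1 0"])
        (use 3 det in \<open>auto simp: A M2_def SL2_def nonneg_mat_iff cols_agree_def cols_oppose_def mat2_eq_iff mult2_nth entry_sum_def\<close>)
  next
    case 4
    show thesis
      by (rule that[of M2 "mat2 0 1 (-1) 0"])
        (use 4 det in \<open>auto simp: A M2_def SL2_def nonneg_mat_iff cols_agree_def cols_oppose_def mat2_eq_iff mult2_nth entry_sum_def\<close>)
  qed
qed

section \<open>Growth of cocycles\<close>

lemma uhp_iff: "\<tau> \<in> uhp \<longleftrightarrow> Im \<tau> > 0"
  by (simp add: uhp_def)

lemma aut_factor_nonzero:
  assumes "W \<in> SL2" "\<tau> \<in> uhp"
  shows "aut_factor W \<tau> \<noteq> 0"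
proof
  assume *: "aut_factor W \<tau> = 0"
  then have "of_int (W$2$1) * Im \<tau> = 0"
    by (simp add: aut_factor_def complex_eq_iff)
  then have "W$2$1 = 0" using assms(2) by (simp add: uhp_iff)
  moreover from this * have "W$2$2 = 0" by (simp add: aut_factor_def)
  ultimately show False using SL2_row_nonzero[OF assms(1), of 2] by simp
qed

lemma aut_factor_mult:
  assumes "W \<in> SL2" "\<tau> \<in> uhp"
  shows "aut_factor (A ** W) \<tau> = aut_factor A (moeb W \<tau>) * aut_factor W \<tau>"
  using aut_factor_nonzero[OF assms]
  by (simp add: aut_factor_def[of A] aut_factor_def[of "A ** W"] moeb_def field_simps mult2_nth)
     (simp add: aut_factor_def algebra_simps)

lemma moeb_mult:
  assumes "W \<in> SL2" "\<tau> \<in> uhp"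
  shows "moeb (A ** W) \<tau> = moeb A (moeb W \<tau>)"
proof -
  have "of_int ((A ** W)$1$1) * \<tau> + of_int ((A ** W)$1$2) =
      (of_int (A$1$1) * moeb W \<tau> + of_int (A$1$2)) * aut_factor W \<tau>"
    using aut_factor_nonzero[OF assms]
    by (simp add: moeb_def field_simps mult2_nth) (simp add: aut_factor_def algebra_simps)
  then show ?thesis
    using aut_factor_nonzero[OF assms]
    unfolding moeb_def[of "A ** W"] moeb_def[of A] aut_factor_mult[OF assms] by simp
qed

lemma Im_moeb:
  assumes "W \<in> SL2"
  shows "Im (moeb W \<tau>) = Im \<tau> / (norm (aut_factor W \<tau>))\<^sup>2"
proof -
  define a b c d where "a = real_of_int (W$1$1)" "b = real_of_int (W$1$2)"
    "c = real_of_int (W$2$1)" "d = real_of_int (W$2$2)"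
  have det: "a * d - b * c = 1"
    using assms unfolding SL2_def a_b_c_d_def by (simp flip: of_int_mult of_int_diff)
  have "Im (moeb W \<tau>) = (a * d - b * c) * Im \<tau> / (norm (aut_factor W \<tau>))\<^sup>2"
    unfolding moeb_def aut_factor_def cmod_power2
    by (simp add: Im_divide a_b_c_d_def algebra_simps)
  then show ?thesis using det by simp
qed

lemma moeb_uhp: "W \<in> SL2 \<Longrightarrow> \<tau> \<in> uhp \<Longrightarrow> moeb W \<tau> \<in> uhp"
  using aut_factor_nonzero[of W \<tau>] by (simp add: uhp_iff Im_moeb)

lemma aut_factor_one [simp]: "aut_factor (mat 1) \<tau> = 1"
  and moeb_one [simp]: "moeb (mat 1) \<tau> = \<tau>"
  by (simp_all add: aut_factor_def moeb_def)

section \<open>Norms of slashed functions\<close>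

lemma norm_rpow: "norm (rpow z w) = norm z powr w"
  by (simp add: rpow_def)

lemma norm_power2_vec: "(norm (x :: complex^'p))\<^sup>2 = (\<Sum>i\<in>UNIV. (norm (x$i))\<^sup>2)"
  by (simp add: norm_vec_def L2_set_def sum_nonneg)

lemma norm_matrix_inv_unitary:
  fixes A :: "complex^'p^'p"
  assumes "A \<in> carrier unitary_group"
  shows "norm (matrix_inv A *v x) = norm x"
proof -
  define B :: "complex^'p^'p" where "B = (\<chi> i j. cnj (A$j$i))"
  have AB: "A ** B = mat 1" using assms by (simp add: unitary_group_def B_def)
  then have BA: "B ** A = mat 1" by (simp add: matrix_left_right_inverse)
  \<comment> \<open>\<open>matrix_inv\<close> is defined by choice: the conjugate transpose
    \<open>B\<close> witnesses existence, and uniqueness of inverses then identifies the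
    two.\<close>
  have "A ** matrix_inv A = mat 1 \<and> matrix_inv A ** A = mat 1"
    unfolding matrix_inv_def by (rule someI[of _ B]) (simp add: AB BA)
  then have "matrix_inv A = B"
    by (metis AB matrix_mul_assoc matrix_mul_lid matrix_mul_rid)
  moreover have "norm (B *v x) = norm x"
  proof -
    \<comment> \<open>The columns of \<open>B\<close> are orthonormal; this is
      \<open>A ** B = mat 1\<close> read entrywise.\<close>
    have delta: "(\<Sum>i\<in>UNIV. B$i$j * cnj (B$i$k)) = (if k = j then 1 else 0)" for j k
    proof -
      have "(A ** B)$k$j = (\<Sum>i\<in>UNIV. B$i$j * cnj (B$i$k))"
        by (simp add: matrix_matrix_mult_def B_def mult.commute)
      then show ?thesis by (simp add: AB mat_def)
    qed
    have "complex_of_real ((norm (B *v x))\<^sup>2) = (\<Sum>i\<in>UNIV. (B *v x)$i * cnj ((B *v x)$i))"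
      unfolding norm_power2_vec by (simp add: complex_norm_square del: of_real_power)
    also have "\<dots> = (\<Sum>i\<in>UNIV. \<Sum>j\<in>UNIV. \<Sum>k\<in>UNIV. (x$j * cnj (x$k)) * (B$i$j * cnj (B$i$k)))"
      by (simp add: matrix_vector_mult_def sum_product ac_simps)
    also have "\<dots> = (\<Sum>j\<in>UNIV. \<Sum>k\<in>UNIV. \<Sum>i\<in>UNIV. (x$j * cnj (x$k)) * (B$i$j * cnj (B$i$k)))"
      by (subst sum.swap) (intro sum.cong refl sum.swap)
    also have "\<dots> = (\<Sum>j\<in>UNIV. \<Sum>k\<in>UNIV. (x$j * cnj (x$k)) * (if k = j then 1 else 0))"
      by (simp only: delta flip: sum_distrib_left)
    also have "\<dots> = (\<Sum>j\<in>UNIV. x$j * cnj (x$j))"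
      by (simp add: if_distrib cong: if_cong)
    also have "\<dots> = complex_of_real ((norm x)\<^sup>2)"
      unfolding norm_power2_vec by (simp add: complex_norm_square del: of_real_power)
    finally have "(norm (B *v x))\<^sup>2 = (norm x)\<^sup>2" by (simp only: of_real_eq_iff)
    then show ?thesis by simp
  qed
  ultimately show ?thesis by simp
qed

lemma norm_vector_scalar_mult: "norm (c *s (x :: complex^'p)) = norm c * norm x"
proof -
  have "(norm (c *s x))\<^sup>2 = (norm c * norm x)\<^sup>2"
    by (simp add: norm_power2_vec norm_mult power_mult_distrib sum_distrib_left)
  then show ?thesis by (simp add: power2_eq_iff_nonneg)
qed

lemma norm_slash_unitary:
  assumes "norm (chi \<gamma>) = 1" "\<rho> \<gamma> \<in> carrier unitary_group"
  shows "norm (slash k chi \<rho> f \<gamma> \<tau>) = norm (aut_factor \<gamma> \<tau>) powr k * norm (f (moeb \<gamma> \<tau>))"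
  using assms by (simp add: slash_def norm_vector_scalar_mult norm_mult norm_inverse norm_rpow
      norm_matrix_inv_unitary)

lemma entry_sum_mult_powr:
  assumes "E \<ge> 0"
  shows "real_of_int (entry_sum (A ** W)) powr E \<le> real_of_int (entry_sum A) powr E * real_of_int (entry_sum W) powr E"
proof -
  have "real_of_int (entry_sum (A ** W)) powr E \<le> (real_of_int (entry_sum A * entry_sum W)) powr E"
    using assms entry_sum_mult[of A W] entry_sum_nonneg[of "A ** W"]
    by (intro powr_mono2) (simp_all flip: of_int_mult)
  then show ?thesis using entry_sum_nonneg by (simp add: powr_mult)
qed

section \<open>From bounds on generators to bounds on fixed group elements\<close>

text \<open>All constants are uniform on \<open>C\<close>, which will be a compact set, and
  \<open>E\<close> will be \<open>2 * e\<close>. The bound on a generator is required after slashing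
  with every \<open>W\<close>, because the cocycle relation expresses values on products through
  slashed values.\<close>

locale bounded_cocycle =
  fixes \<Gamma> S :: "(int^2^2) set" and k :: real and chi :: "int^2^2 \<Rightarrow> complex"
    and \<rho> :: "int^2^2 \<Rightarrow> complex^'p^'p" and g :: "int^2^2 \<Rightarrow> complex \<Rightarrow> complex^'p"
    and C :: "complex set" and E :: real
  assumes gens: "generate SL2Z S = \<Gamma>" and finite_gens: "finite S" and gens_SL2: "S \<subseteq> SL2"
    and norm_chi: "\<And>\<gamma>. \<gamma> \<in> \<Gamma> \<Longrightarrow> norm (chi \<gamma>) = 1"
    and unitary: "\<And>\<gamma>. \<gamma> \<in> \<Gamma> \<Longrightarrow> \<rho> \<gamma> \<in> carrier unitary_group"
    and cocycle: "\<And>\<gamma>\<^sub>1 \<gamma>\<^sub>2 \<tau>. \<gamma>\<^sub>1 \<in> \<Gamma> \<Longrightarrow> \<gamma>\<^sub>2 \<in> \<Gamma> \<Longrightarrow> \<tau> \<in> uhp \<Longrightarrow>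
        g (\<gamma>\<^sub>1 ** \<gamma>\<^sub>2) \<tau> = g \<gamma>\<^sub>2 \<tau> + slash k chi \<rho> (g \<gamma>\<^sub>1) \<gamma>\<^sub>2 \<tau>"
    and C_uhp: "C \<subseteq> uhp" and E_nonneg: "E \<ge> 0"
    and gens_bound: "\<And>f. f \<in> S \<Longrightarrow> \<exists>B\<ge>0. \<forall>W\<in>\<Gamma>. \<forall>\<tau>\<in>C.
        norm (slash k chi \<rho> (g f) W \<tau>) \<le> B * real_of_int (entry_sum W) powr E"
begin

abbreviation sl :: "(complex \<Rightarrow> complex^'p) \<Rightarrow> int^2^2 \<Rightarrow> complex \<Rightarrow> complex^'p" where
  "sl \<equiv> slash k chi \<rho>"

lemma in_SL2: "\<gamma> \<in> \<Gamma> \<Longrightarrow> \<gamma> \<in> SL2"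
  using group.generate_incl[OF group_SL2Z] gens_SL2 gens by (auto simp: carrier_SL2Z)

lemma one_in: "mat 1 \<in> \<Gamma>"
  using generate.one[of SL2Z S] gens by simp

lemma mult_in: "x \<in> \<Gamma> \<Longrightarrow> y \<in> \<Gamma> \<Longrightarrow> x ** y \<in> \<Gamma>"
  using generate.eng[of x SL2Z S y] gens by simp

lemma adj2_in: "x \<in> \<Gamma> \<Longrightarrow> adj2 x \<in> \<Gamma>"
  using group.generate_m_inv_closed[OF group_SL2Z, of S x] gens gens_SL2 SL2Z_inv[of x] in_SL2[of x]
  by (simp add: carrier_SL2Z)

lemma norm_slash:
  "\<gamma> \<in> \<Gamma> \<Longrightarrow> norm (sl f \<gamma> \<tau>) = norm (aut_factor \<gamma> \<tau>) powr k * norm (f (moeb \<gamma> \<tau>))"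
  by (intro norm_slash_unitary norm_chi unitary)

text \<open>In norm, slashing by a product is iterated slashing: \<open>aut_factor\<close> is
  multiplicative, and the modulus removes the multiplier, the branch of the power and the unitary
  matrix.\<close>

lemma norm_slash_mult:
  assumes "A \<in> \<Gamma>" "W \<in> \<Gamma>" "\<tau> \<in> uhp"
  shows "norm (sl f (A ** W) \<tau>) = norm (aut_factor W \<tau>) powr k * norm (sl f A (moeb W \<tau>))"
  using assms aut_factor_mult[of W \<tau> A] moeb_mult[of W \<tau> A] in_SL2[of W]
  by (simp add: norm_slash mult_in norm_mult powr_mult)

lemma norm_slash_cocycle_mult:
  assumes "A \<in> \<Gamma>" "B \<in> \<Gamma>" "W \<in> \<Gamma>" "\<tau> \<in> uhp"
  shows "norm (sl (g (A ** B)) W \<tau>) \<le> norm (sl (g B) W \<tau>) + norm (sl (g A) (B ** W) \<tau>)"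
proof -
  have "moeb W \<tau> \<in> uhp" using assms by (simp add: moeb_uhp in_SL2)
  then have "norm (g (A ** B) (moeb W \<tau>)) \<le> norm (g B (moeb W \<tau>)) + norm (sl (g A) B (moeb W \<tau>))"
    using cocycle[of A B "moeb W \<tau>"] assms by (simp add: norm_triangle_ineq)
  then show ?thesis
    using assms by (simp add: norm_slash[of W] norm_slash_mult flip: distrib_left) (simp add: mult_left_mono)
qed

text \<open>The relation \<open>g 1 = g 1 + g 1 | 1\<close> forces the slashed term to vanish, and
  slashing by the identity preserves the norm.\<close>

lemma g_one: "\<tau> \<in> uhp \<Longrightarrow> g (mat 1) \<tau> = 0"
  using cocycle[of "mat 1" "mat 1" \<tau>] norm_slash[of "mat 1" "g (mat 1)" \<tau>] one_in by simp

text \<open>From the cocycle relation for the product of \<open>A\<close> and its inverse, whose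
  value is \<open>g (mat 1) = 0\<close>.\<close>

lemma norm_slash_g_adj2:
  assumes "A \<in> \<Gamma>" "W \<in> \<Gamma>" "\<tau> \<in> uhp"
  shows "norm (sl (g (adj2 A)) W \<tau>) = norm (sl (g A) (adj2 A ** W) \<tau>)"
proof -
  have "moeb W \<tau> \<in> uhp" using assms by (simp add: moeb_uhp in_SL2)
  then have "g (adj2 A) (moeb W \<tau>) = - sl (g A) (adj2 A) (moeb W \<tau>)"
    using cocycle[of A "adj2 A" "moeb W \<tau>"] assms g_one[of "moeb W \<tau>"]
    by (simp add: adj2_in adj2_right in_SL2 eq_neg_iff_add_eq_0)
  then show ?thesis
    using assms by (simp add: norm_slash_mult adj2_in norm_slash[of W])
qed

text \<open>The constant depends on \<open>f\<close> and deteriorates with the length of a word for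
  \<open>f\<close>. The property is therefore used only for finitely many \<open>f\<close>, and
  growth in \<open>V\<close> comes from short factorizations.\<close>

definition slash_bounded :: "int^2^2 \<Rightarrow> bool" where
  "slash_bounded f \<longleftrightarrow> (\<exists>B\<ge>0. \<forall>W\<in>\<Gamma>. \<forall>\<tau>\<in>C. norm (sl (g f) W \<tau>) \<le> B * real_of_int (entry_sum W) powr E)"

text \<open>Use \<open>g (A ** B) | W = g B | W + g A | (B ** W)\<close> up to factors of modulus 1,
  and submultiplicativity of the entry sum.\<close>

lemma slash_bounded_mult:
  assumes "slash_bounded A" "slash_bounded B" "A \<in> \<Gamma>" "B \<in> \<Gamma>"
  shows "slash_bounded (A ** B)"
proof -
  obtain a b where a: "a \<ge> 0" "\<And>W \<tau>. W \<in> \<Gamma> \<Longrightarrow> \<tau> \<in> C \<Longrightarrow> norm (sl (g A) W \<tau>) \<le> a * real_of_int (entry_sum W) powr E"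
    and b: "b \<ge> 0" "\<And>W \<tau>. W \<in> \<Gamma> \<Longrightarrow> \<tau> \<in> C \<Longrightarrow> norm (sl (g B) W \<tau>) \<le> b * real_of_int (entry_sum W) powr E"
    using assms(1,2) unfolding slash_bounded_def by blast
  define c where "c = b + a * real_of_int (entry_sum B) powr E"
  show ?thesis unfolding slash_bounded_def
  proof (intro exI[of _ c] conjI ballI)
    show "c \<ge> 0" using a(1) b(1) by (simp add: c_def)
    fix W \<tau> assume W: "W \<in> \<Gamma>" "\<tau> \<in> C"
    have "norm (sl (g (A ** B)) W \<tau>) \<le> norm (sl (g B) W \<tau>) + norm (sl (g A) (B ** W) \<tau>)"
      using W assms C_uhp by (intro norm_slash_cocycle_mult) auto
    also have "\<dots> \<le> b * real_of_int (entry_sum W) powr E + a * real_of_int (entry_sum (B ** W)) powr E"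
      using W assms by (intro add_mono a b mult_in)
    also have "\<dots> \<le> b * real_of_int (entry_sum W) powr E
        + a * (real_of_int (entry_sum B) powr E * real_of_int (entry_sum W) powr E)"
      using a(1) entry_sum_mult_powr[OF E_nonneg] by (intro add_left_mono mult_left_mono)
    finally show "norm (sl (g (A ** B)) W \<tau>) \<le> c * real_of_int (entry_sum W) powr E"
      by (simp add: c_def algebra_simps)
  qed
qed

lemma slash_bounded_adj2:
  assumes "slash_bounded A" "A \<in> \<Gamma>"
  shows "slash_bounded (adj2 A)"
proof -
  obtain a where a: "a \<ge> 0" "\<And>W \<tau>. W \<in> \<Gamma> \<Longrightarrow> \<tau> \<in> C \<Longrightarrow> norm (sl (g A) W \<tau>) \<le> a * real_of_int (entry_sum W) powr E"
    using assms(1) unfolding slash_bounded_def by blast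
  define c where "c = a * real_of_int (entry_sum A) powr E"
  show ?thesis unfolding slash_bounded_def
  proof (intro exI[of _ c] conjI ballI)
    show "c \<ge> 0" using a(1) by (simp add: c_def)
    fix W \<tau> assume W: "W \<in> \<Gamma>" "\<tau> \<in> C"
    have "norm (sl (g (adj2 A)) W \<tau>) = norm (sl (g A) (adj2 A ** W) \<tau>)"
      using W assms C_uhp by (intro norm_slash_g_adj2) auto
    also have "\<dots> \<le> a * real_of_int (entry_sum (adj2 A ** W)) powr E"
      using W assms by (intro a mult_in adj2_in)
    also have "\<dots> \<le> a * (real_of_int (entry_sum (adj2 A)) powr E * real_of_int (entry_sum W) powr E)"
      using a(1) entry_sum_mult_powr[OF E_nonneg] by (intro mult_left_mono)
    finally show "norm (sl (g (adj2 A)) W \<tau>) \<le> c * real_of_int (entry_sum W) powr E"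
      by (simp add: c_def algebra_simps)
  qed
qed

lemma slash_bounded_all:
  assumes "f \<in> \<Gamma>"
  shows "slash_bounded f"
proof -
  have incl: "h \<in> \<Gamma>" if "h \<in> S" for h using that generate.incl[of h S SL2Z] gens by simp
  have S: "slash_bounded h" if "h \<in> S" for h
    using gens_bound[OF that] by (simp add: slash_bounded_def)
  have "f \<in> generate SL2Z S" using assms gens by simp
  then show ?thesis
  proof induction
    case one
    have "norm (sl (g (mat 1)) W \<tau>) = 0" if "W \<in> \<Gamma>" "\<tau> \<in> C" for W \<tau>
      using that C_uhp by (simp add: norm_slash g_one moeb_uhp in_SL2 subset_iff)
    then show ?case unfolding slash_bounded_def by (intro exI[of _ 0]) auto
  next
    case (incl h)
    then show ?case by (rule S)
  next
    case (inv h)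
    then show ?case using slash_bounded_adj2[OF S incl] SL2Z_inv[of h] gens_SL2 by auto
  next
    case (eng h1 h2)
    then show ?case using slash_bounded_mult[of h1 h2] gens by simp
  qed
qed

lemma slash_bounded_uniform:
  assumes "finite F" "F \<subseteq> \<Gamma>"
  shows "\<exists>B\<ge>0. \<forall>f\<in>F. \<forall>W\<in>\<Gamma>. \<forall>\<tau>\<in>C. norm (sl (g f) W \<tau>) \<le> B * real_of_int (entry_sum W) powr E"
  using assms
proof (induction F)
  case (insert f F)
  then obtain B where B: "B \<ge> 0"
    "\<And>f W \<tau>. f \<in> F \<Longrightarrow> W \<in> \<Gamma> \<Longrightarrow> \<tau> \<in> C \<Longrightarrow> norm (sl (g f) W \<tau>) \<le> B * real_of_int (entry_sum W) powr E"
    by auto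
  obtain b where b: "b \<ge> 0"
    "\<And>W \<tau>. W \<in> \<Gamma> \<Longrightarrow> \<tau> \<in> C \<Longrightarrow> norm (sl (g f) W \<tau>) \<le> b * real_of_int (entry_sum W) powr E"
    using slash_bounded_all[of f] insert.prems unfolding slash_bounded_def by auto
  have mono: "x * real_of_int (entry_sum W) powr E \<le> (B + b) * real_of_int (entry_sum W) powr E"
    if "x \<le> B + b" for x W using that by (intro mult_right_mono) auto
  show ?case
  proof (intro exI[of _ "B + b"] conjI ballI)
    fix f' W \<tau> assume "f' \<in> insert f F" "W \<in> \<Gamma>" "\<tau> \<in> C"
    then show "norm (sl (g f') W \<tau>) \<le> (B + b) * real_of_int (entry_sum W) powr E"
      using mono[of B W] mono[of b W] B(1) b(1) B(2)[of f' W \<tau>] b(2)[of W \<tau>] by (cases "f' = f") auto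
  qed (use B b in auto)
qed auto

section \<open>Short factorizations and polynomial growth\<close>

text \<open>The finitely many relative positions \<open>y = adj2 M ** x\<close> from which one
  generator, or its inverse, carries \<open>x\<close> over the edge
  \<open>M{0, \<infinity>}\<close>; \<open>mat 1\<close> adds the case of \<open>x\<close> lying on
  that edge.\<close>

definition switches :: "(int^2^2) set" where
  "switches = (\<Union>s\<in>insert (mat 1) (S \<union> adj2 ` S). {y \<in> SL2. cols_oppose y \<and> cols_agree (y ** s)})"

lemma finite_switches: "finite switches"
  unfolding switches_def using finite_gens gens_SL2
  by (intro finite_UN_I finite_cols_switch) (auto intro: SL2_adj2)

lemma switches_SL2: "y \<in> switches \<Longrightarrow> y \<in> SL2"
  by (auto simp: switches_def)

text \<open>With \<open>Y = adj2 M\<close> this produces \<open>x \<in> \<Gamma>\<close> of the form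
  \<open>M ** y\<close> with \<open>y\<close> in a finite set, that is, a group element within
  bounded distance of \<open>M\<close>.\<close>

lemma switch_on_path:
  assumes "Y \<in> SL2" "cols_oppose Y" "h \<in> \<Gamma>" "cols_agree (Y ** h)"
  shows "\<exists>x\<in>\<Gamma>. Y ** x \<in> switches"
proof -
  from cols_switch_on_path[OF _ gens_SL2 assms(1,2,4)] assms(3) gens
  obtain x s where "x \<in> \<Gamma>" "s \<in> insert (mat 1) (S \<union> adj2 ` S)"
    "cols_oppose (Y ** x)" "cols_agree (Y ** x ** s)" by blast
  moreover from this have "Y ** x \<in> SL2" using assms(1) by (simp add: SL2_mult in_SL2)
  ultimately show ?thesis unfolding switches_def by blast
qed

text \<open>Descending from \<open>M\<close> to its parent costs one cocycle term of order
  \<open>\<parallel>M'\<parallel>^E\<close>, and each descent lowers the entry sum by at least 1.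
  Adding these terms raises the exponent by one.\<close>

theorem cocycle_growth:
  "\<exists>B\<ge>0. \<forall>V\<in>\<Gamma>. \<forall>\<tau>\<in>C. norm (g V \<tau>) \<le> B * real_of_int (entry_sum V) powr (E + 1)"
proof -
  \<comment> \<open>\<open>adj2 A\<close> is the identity or \<open>S2\<close>; a suitable choice
    moves the edge of any \<open>h\<close> into \<open>[0, \<infinity>]\<close>, where nonnegative
    matrices describe it.\<close>
  define AA where "AA = {mat 1, adj2 S2}"
  define TT where "TT = {mat2 1 1 0 1, mat2 1 0 1 1}"
  \<comment> \<open>All factors that occur, inverted because the path leads to the inverse of
    \<open>V\<close>: the final elements \<open>A ** y\<close>, and the transitions between the
    group elements near consecutive nodes \<open>M'\<close> and \<open>M' ** T\<close>.\<close>
  define Fs where "Fs = \<Gamma> \<inter> ((\<lambda>(A, y). adj2 (A ** y)) ` (AA \<times> switches) \<union>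
      (\<lambda>(y', T, y). adj2 (adj2 y' ** T ** y)) ` (switches \<times> TT \<times> switches))"
  have AA: "A \<in> SL2" "entry_sum A = 2" "cols_oppose (Y ** adj2 A) \<longleftrightarrow> cols_oppose Y" if "A \<in> AA" for A Y
    using that SL2_adj2[OF S2_SL2] cols_oppose_mult_S2[of Y]
    by (auto simp: AA_def adj2_def S2_def entry_sum_def)
       (auto simp: mat2_eq_iff mult2_nth cols_oppose_def)
  have TT: "T \<in> SL2" "nonneg_mat T" if "T \<in> TT" for T
    using that by (auto simp: TT_def SL2_def nonneg_mat_iff)
  have "finite Fs" unfolding Fs_def AA_def TT_def
    using finite_switches by (intro finite_Int disjI2 finite_UnI finite_imageI finite_cartesian_product) auto
  moreover have "Fs \<subseteq> \<Gamma>" by (auto simp: Fs_def)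
  ultimately obtain B where B: "B \<ge> 0"
    "\<And>f W \<tau>. f \<in> Fs \<Longrightarrow> W \<in> \<Gamma> \<Longrightarrow> \<tau> \<in> C \<Longrightarrow> norm (sl (g f) W \<tau>) \<le> B * real_of_int (entry_sum W) powr E"
    using slash_bounded_uniform[of Fs] by blast
  define D where "D = 1 + (\<Sum>y\<in>switches. entry_sum y)"
  have D: "entry_sum y \<le> D" if "y \<in> switches" for y
    using member_le_sum[of y switches entry_sum] that finite_switches entry_sum_nonneg
    by (fastforce simp: D_def)
  have D1: "D \<ge> 1" unfolding D_def using sum_nonneg[of switches entry_sum] entry_sum_nonneg by simp
  \<comment> \<open>The group element near \<open>A ** M'\<close> has entry sum at most
    \<open>2 * D\<close> times that of \<open>M'\<close>: the 2 is the entry sum of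
    \<open>A\<close>, and \<open>D\<close> bounds that of every switch.\<close>
  define B' where "B' = B * real_of_int (2 * D) powr E"
  have BB': "B \<le> B'"
  proof -
    have "1 \<le> real_of_int (2 * D) powr E" using D1 E_nonneg by (intro ge_one_powr_ge_zero) auto
    then show ?thesis using B(1) mult_left_mono[of 1 _ B] by (simp add: B'_def)
  qed
  \<comment> \<open>The target \<open>h\<close> stays fixed. The hypothesis that its edge lies in
    the interval of \<open>A ** M\<close> is what forces a path to \<open>h\<close> to cross the
    edge of every ancestor of \<open>M\<close>; \<open>y\<close> is arbitrary so that any nearby
    group element may serve at the next stage.\<close>
  have main: "norm (g (adj2 (A ** M ** y)) \<tau>) \<le> B' * real_of_int (entry_sum M) powr (E + 1)"
    if "M \<in> SL2" "nonneg_mat M" "A \<in> AA" "y \<in> switches" "h \<in> \<Gamma>" "cols_agree (adj2 M ** adj2 A ** h)"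
      "A ** M ** y \<in> \<Gamma>" "\<tau> \<in> C" for M A y h \<tau>
    using that
  proof (induction "nat (entry_sum M)" arbitrary: M y rule: less_induct)
    case less
    have \<tau>: "\<tau> \<in> uhp" using less.prems C_uhp by auto
    show ?case
    proof (rule nonneg_mat_cases[OF less.prems(1,2)])
      assume M: "M = mat 1"
      have "adj2 (A ** y) \<in> Fs"
        using less.prems adj2_in[of "A ** y"] by (auto simp: Fs_def M)
      from B(2)[OF this one_in less.prems(8)]
      have "norm (g (adj2 (A ** y)) \<tau>) \<le> B * real_of_int (entry_sum (mat 1)) powr E"
        by (simp add: norm_slash one_in)
      also have "\<dots> \<le> B' * real_of_int (entry_sum (mat 1)) powr (E + 1)"
        using BB' B(1) by (intro mult_mono powr_mono) (auto simp: entry_sum_def)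
      finally show ?thesis by (simp add: M)
    next
      fix M' T assume M': "M' \<in> SL2" "nonneg_mat M'" "T \<in> {mat2 1 1 0 1, mat2 1 0 1 1}" "M = M' ** T"
        "entry_sum M' + 1 \<le> entry_sum M"
      then have T: "T \<in> TT" by (simp add: TT_def)
      have A: "A \<in> SL2" using AA less.prems by blast
      have "adj2 M' ** adj2 A ** h = T ** (adj2 M ** adj2 A ** h)"
        using adj2_right[OF TT(1)[OF T]] by (simp add: M'(4) adj2_mult matrix_mul_assoc)
      then have agree: "cols_agree (adj2 M' ** adj2 A ** h)"
        using cols_agree_nonneg_mult[OF TT(2)[OF T] less.prems(6)] by simp
      \<comment> \<open>The path to \<open>h\<close> starts at the identity, outside the interior of
        the parent interval, and by \<open>agree\<close> ends inside it. It therefore passes through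
        a group element \<open>x'\<close> near \<open>A ** M'\<close>.\<close>
      have "cols_oppose (adj2 M' ** adj2 A)"
        using AA(3)[OF less.prems(3)] cols_oppose_adj2_nonneg[OF M'(2)] by blast
      then obtain x' where x': "x' \<in> \<Gamma>" "adj2 M' ** adj2 A ** x' \<in> switches"
        using switch_on_path[OF SL2_mult[OF SL2_adj2[OF M'(1)] SL2_adj2[OF A]] _ less.prems(5) agree] by blast
      define y' where "y' = adj2 M' ** adj2 A ** x'"
      have y': "y' \<in> switches" "y' \<in> SL2" using x' switches_SL2 by (auto simp: y'_def)
      have x'_eq: "x' = A ** M' ** y'"
      proof -
        have "A ** M' ** y' = A ** (M' ** adj2 M') ** adj2 A ** x'"
          by (simp add: y'_def matrix_mul_assoc)
        then show ?thesis using adj2_right[OF M'(1)] adj2_right[OF A] by simp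
      qed
      have small: "nat (entry_sum M') < nat (entry_sum M)"
        using M'(5) entry_sum_nonneg[of M'] by simp
      have IH: "norm (g (adj2 x') \<tau>) \<le> B' * real_of_int (entry_sum M') powr (E + 1)"
        unfolding x'_eq
        by (rule less.hyps[OF small M'(1,2) less.prems(3) y'(1) less.prems(5) agree _ less.prems(8)])
           (use x'(1) x'_eq in simp)
      \<comment> \<open>\<open>f\<close> is the transition from the element near the parent to the
        one near \<open>M\<close>. Inverting \<open>x = x' ** f\<close> puts \<open>adj2 f\<close>
        on the left, so the cocycle relation slashes only its value, which \<open>Fs\<close>
        controls.\<close>
      define x f where "x = A ** M ** y" and "f = adj2 y' ** T ** y"
      have "x' ** f = A ** M' ** (y' ** adj2 y') ** T ** y"
        by (simp add: x'_eq f_def matrix_mul_assoc)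
      then have x_eq: "x = x' ** f"
        using adj2_right[OF y'(2)] by (simp add: x_def M'(4) matrix_mul_assoc)
      have x_in: "x \<in> \<Gamma>" using less.prems by (simp add: x_def)
      have "adj2 x' ** x = f" using adj2_left[OF in_SL2[OF x'(1)]] by (simp add: x_eq matrix_mul_assoc)
      then have f_in: "f \<in> \<Gamma>" using mult_in[OF adj2_in[OF x'(1)] x_in] by simp
      have "adj2 f \<in> Fs"
        unfolding Fs_def using adj2_in[OF f_in] y'(1) T less.prems(4)
        by (auto simp: f_def intro!: image_eqI[of _ _ "(y', T, y)"])
      then have step: "norm (sl (g (adj2 f)) (adj2 x') \<tau>) \<le> B * real_of_int (entry_sum (adj2 x')) powr E"
        using B(2) adj2_in[OF x'(1)] less.prems(8) by blast
      have "entry_sum x' \<le> entry_sum A * entry_sum M' * entry_sum y'"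
        unfolding x'_eq using entry_sum_mult[of "A ** M'" y'] entry_sum_mult[of A M'] entry_sum_nonneg[of y']
        by (meson mult_right_mono order_trans)
      also have "\<dots> \<le> 2 * entry_sum M' * D"
        using AA(2)[OF less.prems(3)] D[OF y'(1)] entry_sum_nonneg[of M'] by (simp add: mult_left_mono)
      finally have "entry_sum x' \<le> (2 * D) * entry_sum M'" by (simp add: ac_simps)
      then have "real_of_int (entry_sum x') powr E \<le> (real_of_int ((2 * D) * entry_sum M')) powr E"
        using E_nonneg entry_sum_nonneg[of x'] by (intro powr_mono2) (auto simp only: of_int_le_iff of_int_0_le_iff)
      also have "\<dots> = real_of_int (2 * D) powr E * real_of_int (entry_sum M') powr E"
        unfolding of_int_mult[of "2 * D"] by (rule powr_mult)
      finally have "B * real_of_int (entry_sum x') powr E \<le> B' * real_of_int (entry_sum M') powr E"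
        using mult_left_mono[OF _ B(1)] by (simp add: B'_def mult.assoc)
      with step have step': "norm (sl (g (adj2 f)) (adj2 x') \<tau>) \<le> B' * real_of_int (entry_sum M') powr E" by simp
      have "norm (g (adj2 x) \<tau>) \<le> norm (g (adj2 x') \<tau>) + norm (sl (g (adj2 f)) (adj2 x') \<tau>)"
        unfolding x_eq adj2_mult using cocycle[OF adj2_in[OF f_in] adj2_in[OF x'(1)] \<tau>]
        by (simp add: norm_triangle_ineq)
      also have "\<dots> \<le> B' * real_of_int (entry_sum M') powr (E + 1) + B' * real_of_int (entry_sum M') powr E"
        using IH step' by simp
      also have "\<dots> = B' * (real_of_int (entry_sum M') powr E * real_of_int (entry_sum M' + 1))"
        using entry_sum_ge_1[OF M'(1)] by (simp add: powr_add algebra_simps)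
      \<comment> \<open>With \<open>n = entry_sum M'\<close>, the sum of both terms is
        \<open>n^E * (n + 1)\<close>, and \<open>n + 1\<close> is at most the entry sum of
        \<open>M\<close>.\<close>
      also have "\<dots> \<le> B' * (real_of_int (entry_sum M) powr E * real_of_int (entry_sum M))"
        using M'(5) entry_sum_nonneg[of M'] E_nonneg B(1) BB'
        by (intro mult_left_mono mult_mono powr_mono2) auto
      also have "\<dots> = B' * real_of_int (entry_sum M) powr (E + 1)"
        using entry_sum_ge_1[OF less.prems(1)] by (simp add: powr_add)
      finally show ?thesis by (simp add: x_def)
    qed
  qed
  have final: "norm (g V \<tau>) \<le> B' * real_of_int (entry_sum V) powr (E + 1)" if V: "V \<in> \<Gamma>" "\<tau> \<in> C" for V \<tau>
  proof -
    define h where "h = adj2 V"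
    have h: "h \<in> \<Gamma>" "h \<in> SL2" using V adj2_in in_SL2 by (auto simp: h_def)
    obtain A where A: "A \<in> AA" "cols_agree (adj2 A ** h)"  "entry_sum (adj2 A ** h) = entry_sum h"
    proof (cases "cols_agree h")
      case True
      moreover have "adj2 (mat 1) = mat 1" by (simp add: mat2_eq_iff)
      ultimately show ?thesis using that[of "mat 1"] by (auto simp: AA_def)
    next
      case False
      then have "cols_oppose h" using cols_agree_or_oppose h by blast
      then show ?thesis
        using that[of "adj2 S2"] by (auto simp: AA_def cols_agree_S2_mult entry_sum_S2_mult)
    qed
    have A2: "A \<in> SL2" using AA A by blast
    obtain M y where M: "M \<in> SL2" "nonneg_mat M" "y \<in> SL2" "cols_agree y" "cols_oppose y"
      "adj2 A ** h = M ** y" "entry_sum M = entry_sum (adj2 A ** h)"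
      using cols_agree_factor[OF SL2_mult[OF SL2_adj2[OF A2] h(2)] A(2)] .
    have h_eq: "A ** M ** y = h"
      using M(6) adj2_right[OF A2] by (metis matrix_mul_assoc matrix_mul_lid)
    \<comment> \<open>The descent starts at \<open>h\<close> itself: \<open>y\<close> is of both
      types, so it is a switch with \<open>s = mat 1\<close>.\<close>
    have y: "y \<in> switches" using M by (simp add: switches_def)
    have "adj2 M ** adj2 A ** h = adj2 M ** (M ** y)" using M(6) by (simp flip: matrix_mul_assoc)
    then have "adj2 M ** adj2 A ** h = y" using adj2_left[OF M(1)] by (simp add: matrix_mul_assoc)
    then have "norm (g (adj2 (A ** M ** y)) \<tau>) \<le> B' * real_of_int (entry_sum M) powr (E + 1)"
      using M h h_eq by (intro main[OF M(1,2) A(1) y h(1) _ _ V(2)]) auto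
    then show ?thesis using M(7) A(3) by (simp add: h_eq) (simp add: h_def)
  qed
  show ?thesis using final B(1) BB' by (intro exI[of _ B']) auto
qed

end

section \<open>Convergence of the series\<close>

lemma compact_uhp_bounds:
  assumes "compact C" "C \<subseteq> uhp"
  obtains \<delta> R where "\<delta> > 0" "R \<ge> 0" "\<And>\<tau>. \<tau> \<in> C \<Longrightarrow> Im \<tau> \<ge> \<delta>" "\<And>\<tau>. \<tau> \<in> C \<Longrightarrow> norm \<tau> \<le> R"
proof (cases "C = {}")
  case False
  obtain x where "x \<in> C" "\<forall>y\<in>C. Im x \<le> Im y"
    using continuous_attains_inf[OF assms(1) False, of Im] continuous_on_Im[OF continuous_on_id]
    by auto
  moreover obtain R where "R > 0" "\<forall>y\<in>C. norm y \<le> R"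
    using compact_imp_bounded[OF assms(1)] by (auto simp: bounded_pos)
  ultimately show ?thesis using that[of "Im x" R] assms(2) by (auto simp: uhp_iff)
qed (use that[of 1 0] in auto)

text \<open>With \<open>j\<close> the modulus of \<open>c * \<tau> + d\<close>, the imaginary part
  gives \<open>\<bar>c\<bar> \<le> j / \<delta>\<close>, whence
  \<open>\<bar>d\<bar> \<le> j + R * j / \<delta>\<close>; this constant is the sum of the
  coefficients.\<close>

definition row_const :: "real \<Rightarrow> real \<Rightarrow> real" where
  "row_const \<delta> R = 1 / \<delta> + 1 + R / \<delta>"

lemma row_const_pos: "\<delta> > 0 \<Longrightarrow> R \<ge> 0 \<Longrightarrow> row_const \<delta> R > 0"
  by (simp add: row_const_def add_nonneg_pos add_pos_nonneg)

lemma row_sum_le_norm: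
  fixes c d :: int
  assumes "\<delta> > 0" "Im \<tau> \<ge> \<delta>" "norm \<tau> \<le> R"
  shows "real_of_int (\<bar>c\<bar> + \<bar>d\<bar>) \<le> row_const \<delta> R * norm (of_int c * \<tau> + of_int d)"
proof -
  define j where "j = norm (of_int c * \<tau> + of_int d)"
  have R: "R \<ge> 0" using assms(3) norm_ge_zero[of \<tau>] by linarith
  have "\<bar>real_of_int c\<bar> * \<delta> \<le> \<bar>real_of_int c\<bar> * Im \<tau>" using assms(2) by (intro mult_left_mono) auto
  also have "\<dots> = \<bar>Im (of_int c * \<tau> + of_int d)\<bar>" using assms by (simp add: abs_mult)
  also have "\<dots> \<le> j" unfolding j_def by (rule abs_Im_le_cmod)
  finally have c: "\<bar>real_of_int c\<bar> \<le> j / \<delta>" using assms(1) by (simp add: field_simps)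
  have "\<bar>real_of_int d\<bar> = norm ((of_int c * \<tau> + of_int d) - of_int c * \<tau>)" by simp
  also have "\<dots> \<le> j + norm (of_int c * \<tau>)" unfolding j_def by (rule norm_triangle_ineq4)
  also have "norm (of_int c * \<tau>) \<le> (j / \<delta>) * R"
    using mult_mono[OF c assms(3)] R order_trans[OF abs_ge_zero c] by (simp add: norm_mult)
  finally show ?thesis using c by (simp add: row_const_def j_def algebra_simps)
qed

lemma norm_row_le:
  fixes c d :: int and \<tau> :: complex
  assumes "norm \<tau> \<le> R"
  shows "norm (of_int c * \<tau> + of_int d) \<le> (1 + R) * real_of_int (\<bar>c\<bar> + \<bar>d\<bar>)"
proof -
  have R: "R \<ge> 0" using assms norm_ge_zero[of \<tau>] by linarith
  have "norm (of_int c * \<tau> + of_int d) \<le> \<bar>real_of_int c\<bar> * norm \<tau> + \<bar>real_of_int d\<bar>"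
    using norm_triangle_ineq[of "of_int c * \<tau>" "of_int d"] by (simp add: norm_mult)
  also have "\<dots> \<le> \<bar>real_of_int c\<bar> * R + \<bar>real_of_int d\<bar>"
    using assms by (simp add: mult_left_mono)
  also have "\<dots> \<le> (1 + R) * real_of_int (\<bar>c\<bar> + \<bar>d\<bar>)"
    using R by (simp add: algebra_simps)
  finally show ?thesis .
qed

lemma growth_bound_norm:
  fixes f :: "complex \<Rightarrow> complex^'p"
  assumes "growth_bound K \<alpha> \<sigma> f" "\<tau> \<in> uhp"
  shows "norm (f \<tau>) \<le> real CARD('p) * K * (norm \<tau> powr \<alpha> + Im \<tau> powr (- \<sigma>))"
proof -
  have "norm (f \<tau>) \<le> (\<Sum>j\<in>UNIV. norm (f \<tau> $ j))"
    by (simp add: norm_vec_def L2_set_le_sum)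
  also have "\<dots> \<le> (\<Sum>j\<in>(UNIV :: 'p set). K * (norm \<tau> powr \<alpha> + Im \<tau> powr (- \<sigma>)))"
    using assms unfolding growth_bound_def by (intro sum_mono less_imp_le) blast
  finally show ?thesis by simp
qed

text \<open>Let \<open>j\<close> and \<open>N\<close> be the moduli of the denominator and numerator
  of \<open>moeb W \<tau>\<close>. The first term becomes
  \<open>N^\<alpha> * j^(k-\<alpha>)\<close>, where \<open>\<alpha> > k\<close> calls for a lower
  bound on \<open>j\<close>; the second becomes a multiple of \<open>j^(2\<sigma>+k)\<close>, where
  \<open>2\<sigma> > -k\<close> calls for an upper bound. Both exponents of the entry sum are at
  most \<open>E\<close>.\<close>

lemma slash_growth:
  fixes f :: "complex \<Rightarrow> complex^'p"
  assumes "growth_bound K \<alpha> \<sigma> f" "K > 0" "\<alpha> > 0" "\<sigma> > 0" "2 * \<sigma> > - k" "\<alpha> > k"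
    and "\<delta> > 0" "R \<ge> 0"
    and E: "E = max \<alpha> (2 * \<sigma> + k)"
  shows "\<exists>B\<ge>0. \<forall>W\<in>SL2. \<forall>\<tau>. Im \<tau> \<ge> \<delta> \<longrightarrow> norm \<tau> \<le> R \<longrightarrow>
    norm (aut_factor W \<tau>) powr k * norm (f (moeb W \<tau>)) \<le> B * real_of_int (entry_sum W) powr E"
proof -
  \<comment> \<open>A lower bound for \<open>j\<close>: the bottom row is integral and nonzero, so
    its absolute sum is at least 1.\<close>
  define m where "m = 1 / row_const \<delta> R"
  have m: "m > 0" using row_const_pos assms by (simp add: m_def)
  define P where "P = real CARD('p) * K"
  have P: "P \<ge> 0" using assms by (simp add: P_def)
  define B1 where "B1 = (1 + R) powr \<alpha> * m powr (k - \<alpha>)"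
  define B2 where "B2 = \<delta> powr (- \<sigma>) * (1 + R) powr (2 * \<sigma> + k)"
  show ?thesis
  proof (intro exI[of _ "P * (B1 + B2)"] conjI ballI allI impI)
    show "P * (B1 + B2) \<ge> 0" using P by (simp add: B1_def B2_def)
    fix W \<tau> assume W: "W \<in> SL2" and \<tau>: "Im \<tau> \<ge> \<delta>" "norm \<tau> \<le> R"
    define n where "n = real_of_int (entry_sum W)"
    define j where "j = norm (aut_factor W \<tau>)"
    define N where "N = norm (of_int (W$1$1) * \<tau> + of_int (W$1$2))"
    have n: "n \<ge> 1" using entry_sum_ge_1[OF W] by (simp add: n_def)
    have uhp: "\<tau> \<in> uhp" using \<tau> assms by (simp add: uhp_iff)
    have j_le: "j \<le> (1 + R) * n"
    proof -
      have "j \<le> (1 + R) * real_of_int (\<bar>W$2$1\<bar> + \<bar>W$2$2\<bar>)"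
        unfolding j_def aut_factor_def by (rule norm_row_le[OF \<tau>(2)])
      also have "\<dots> \<le> (1 + R) * n"
        using assms by (intro mult_left_mono) (auto simp: n_def entry_sum_def)
      finally show ?thesis .
    qed
    have N_le: "N \<le> (1 + R) * n"
    proof -
      have "N \<le> (1 + R) * real_of_int (\<bar>W$1$1\<bar> + \<bar>W$1$2\<bar>)"
        unfolding N_def by (rule norm_row_le[OF \<tau>(2)])
      also have "\<dots> \<le> (1 + R) * n"
        using assms by (intro mult_left_mono) (auto simp: n_def entry_sum_def)
      finally show ?thesis .
    qed
    have "1 \<le> \<bar>W$2$1\<bar> + \<bar>W$2$2\<bar>" using SL2_row_nonzero[OF W, of 2] by linarith
    then have "1 \<le> real_of_int (\<bar>W$2$1\<bar> + \<bar>W$2$2\<bar>)" by linarith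
    also have "\<dots> \<le> row_const \<delta> R * j"
      unfolding j_def aut_factor_def by (rule row_sum_le_norm[OF assms(7) \<tau>])
    finally have m_le: "m \<le> j" using row_const_pos[OF assms(7,8)] by (simp add: m_def field_simps)
    have j: "j > 0" using m m_le by linarith
    have N0: "N \<ge> 0" by (simp add: N_def)
    have "j powr k * norm (moeb W \<tau>) powr \<alpha> = N powr \<alpha> * j powr (k - \<alpha>)"
      using j by (simp add: moeb_def norm_divide N_def j_def powr_divide powr_diff)
    also have "\<dots> \<le> ((1 + R) * n) powr \<alpha> * m powr (k - \<alpha>)"
      using N_le N0 m m_le assms by (intro mult_mono powr_mono2 powr_mono2') auto
    also have "\<dots> = B1 * n powr \<alpha>"
      using n assms by (simp add: B1_def powr_mult)
    also have "\<dots> \<le> B1 * n powr E"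
      using n by (intro mult_left_mono powr_mono) (auto simp: E B1_def)
    finally have 1: "j powr k * norm (moeb W \<tau>) powr \<alpha> \<le> B1 * n powr E" .
    have "j powr k * Im (moeb W \<tau>) powr (- \<sigma>) = Im \<tau> powr (- \<sigma>) * j powr (2 * \<sigma> + k)"
    proof -
      have "(j\<^sup>2) powr (- \<sigma>) = j powr (- 2 * \<sigma>)"
        using j by (simp add: powr_powr flip: powr_numeral)
      then have "Im (moeb W \<tau>) powr (- \<sigma>) = Im \<tau> powr (- \<sigma>) / j powr (- 2 * \<sigma>)"
        using j uhp by (simp add: Im_moeb[OF W] powr_divide uhp_iff flip: j_def)
      then show ?thesis using j by (simp add: powr_minus powr_add field_simps)
    qed
    also have "\<dots> \<le> \<delta> powr (- \<sigma>) * ((1 + R) * n) powr (2 * \<sigma> + k)"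
      using \<tau> assms j j_le by (intro mult_mono powr_mono2 powr_mono2') auto
    also have "\<dots> = B2 * n powr (2 * \<sigma> + k)"
      using n assms by (simp add: B2_def powr_mult)
    also have "\<dots> \<le> B2 * n powr E"
      using n by (intro mult_left_mono powr_mono) (auto simp: E B2_def)
    finally have 2: "j powr k * Im (moeb W \<tau>) powr (- \<sigma>) \<le> B2 * n powr E" .
    have "j powr k * norm (f (moeb W \<tau>)) \<le>
        j powr k * (P * (norm (moeb W \<tau>) powr \<alpha> + Im (moeb W \<tau>) powr (- \<sigma>)))"
      using growth_bound_norm[OF assms(1) moeb_uhp[OF W uhp]] by (intro mult_left_mono) (auto simp: P_def)
    also have "\<dots> = P * (j powr k * norm (moeb W \<tau>) powr \<alpha> + j powr k * Im (moeb W \<tau>) powr (- \<sigma>))"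
      by (simp add: algebra_simps)
    also have "\<dots> \<le> P * (B1 * n powr E + B2 * n powr E)"
      using P 1 2 by (intro mult_left_mono add_mono)
    finally show "j powr k * norm (f (moeb W \<tau>)) \<le> P * (B1 + B2) * n powr E"
      by (simp add: algebra_simps)
  qed
qed

section \<open>Summation over the coset representatives\<close>

lemma summable_on_int_powr:
  assumes "s > 1"
  shows "(\<lambda>c::int. (1 + \<bar>real_of_int c\<bar>) powr (- s)) summable_on UNIV"
proof -
  let ?f = "\<lambda>c::int. (1 + \<bar>real_of_int c\<bar>) powr (- s)"
  have "summable (\<lambda>n. of_nat n powr (- s) :: real)"
    using assms by (simp add: summable_real_powr_iff)
  then have "summable (\<lambda>n. of_nat (Suc n) powr (- s) :: real)"
    by (subst summable_Suc_iff)
  then have *: "(\<lambda>n. (1 + real n) powr (- s)) summable_on UNIV"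
    by (intro summable_nonneg_imp_summable_on) auto
  have "?f summable_on range int"
    using * by (subst summable_on_reindex) (auto simp: o_def)
  moreover have "?f summable_on range (\<lambda>n. - int n)"
    using * by (subst summable_on_reindex) (auto simp: o_def inj_def)
  ultimately have "?f summable_on (range int \<union> range (\<lambda>n. - int n))"
    by (rule summable_on_union)
  moreover have "range int \<union> range (\<lambda>n. - int n) = UNIV"
    using int_cases2 by blast
  ultimately show ?thesis by simp
qed

lemma summable_on_product_nonneg:
  fixes f :: "'a \<Rightarrow> real" and h :: "'b \<Rightarrow> real"
  assumes "f summable_on A" "h summable_on B" "\<And>x. f x \<ge> 0" "\<And>y. h y \<ge> 0"
  shows "(\<lambda>(x, y). f x * h y) summable_on A \<times> B"
proof (rule summable_on_SigmaI[where g = "\<lambda>x. f x * infsum h B"])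
  show "((\<lambda>y. case (x, y) of (x, y) \<Rightarrow> f x * h y) has_sum f x * infsum h B) B" for x
    using assms(2) by (simp add: has_sum_cmult_right)
qed (use assms in \<open>auto intro: summable_on_cmult_left\<close>)

lemma same_bottom_row:
  assumes "V \<in> SL2" "W \<in> SL2" "V$2$1 = W$2$1" "V$2$2 = W$2$2"
  obtains n where "W$1$1 = V$1$1 + n * V$2$1" "W$1$2 = V$1$2 + n * V$2$2"
proof -
  have V: "V$1$1 * V$2$2 - V$1$2 * V$2$1 = 1" and W: "W$1$1 * V$2$2 - W$1$2 * V$2$1 = 1"
    using assms by (auto simp: SL2_def)
  \<comment> \<open>The upper right entry of \<open>W ** adj2 V\<close>, which is the translation by
    \<open>n\<close>.\<close>
  define n where "n = V$1$1 * W$1$2 - V$1$2 * W$1$1"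
  have "V$1$1 + n * V$2$1 = W$1$1" 
    using V W unfolding n_def by algebra
  moreover have "V$1$2 + n * V$2$2 = W$1$2"
    using V W unfolding n_def by algebra
  ultimately show thesis using that[of n] by simp
qed

text \<open>Matrices with the same bottom row differ by an integral translation, so bottom row and
  integer part of \<open>Re (moeb V z)\<close> determine \<open>V\<close>; in a strip the latter
  takes finitely many values. It remains to sum over pairs \<open>(c, d)\<close>.\<close>

lemma summable_on_strip:
  assumes L: "L \<subseteq> SL2" and z: "z \<in> uhp"
    and strip: "\<And>V. V \<in> L \<Longrightarrow> lo \<le> Re (moeb V z)" "\<And>V. V \<in> L \<Longrightarrow> Re (moeb V z) \<le> hi"
    and \<beta>: "\<beta> > 2"
  shows "(\<lambda>V. real_of_int (entry_sum V) powr (- \<beta>)) summable_on L"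
proof -
  define h where "h V = ((V$2$1, V$2$2), \<lfloor>Re (moeb V z)\<rfloor>)" for V :: "int^2^2"
  \<comment> \<open>The exponent is shared equally between \<open>c\<close> and \<open>d\<close>:
    both \<open>1 + \<bar>c\<bar>\<close> and \<open>1 + \<bar>d\<bar>\<close> are at most twice the
    entry sum, and \<open>\<beta> / 2 > 1\<close> makes each single sum converge.\<close>
  define p where "p c = (1 + \<bar>real_of_int c\<bar>) powr (- (\<beta> / 2))" for c :: int
  define q where "q = (\<lambda>((c, d), m :: int). p c * p d)"
  have inj: "inj_on h L"
  proof (rule inj_onI)
    fix V W assume VW: "V \<in> L" "W \<in> L" "h V = h W"
    then have SL2: "V \<in> SL2" "W \<in> SL2" and row: "V$2$1 = W$2$1" "V$2$2 = W$2$2"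
      and fl: "\<lfloor>Re (moeb V z)\<rfloor> = \<lfloor>Re (moeb W z)\<rfloor>" using L by (auto simp: h_def)
    obtain n where n: "W$1$1 = V$1$1 + n * V$2$1" "W$1$2 = V$1$2 + n * V$2$2"
      using same_bottom_row[OF SL2 row] .
    have aut: "aut_factor W z = aut_factor V z" using row by (simp add: aut_factor_def)
    have "of_int (W$1$1) * z + of_int (W$1$2) =
        of_int (V$1$1) * z + of_int (V$1$2) + of_int n * aut_factor V z"
      by (simp add: n aut_factor_def algebra_simps)
    then have "moeb W z = moeb V z + of_int n"
      using aut_factor_nonzero[OF SL2(1) z] by (simp add: moeb_def aut add_divide_distrib)
    then have "n = 0" using fl by simp
    then show "V = W" using n row by (simp add: mat2_eq_iff)
  qed
  have p: "p summable_on UNIV"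
    unfolding p_def using \<beta> by (intro summable_on_int_powr) simp
  have p0: "p c \<ge> 0" for c by (simp add: p_def)
  have "(\<lambda>(x, m). (case x of (c, d) \<Rightarrow> p c * p d) * (\<lambda>_. 1) m) summable_on
      ((UNIV \<times> UNIV) \<times> {\<lfloor>lo\<rfloor>..\<lfloor>hi\<rfloor>})"
    using p p0 by (intro summable_on_product_nonneg) auto
  then have "q summable_on ((UNIV \<times> UNIV) \<times> {\<lfloor>lo\<rfloor>..\<lfloor>hi\<rfloor>})"
    by (simp add: q_def case_prod_unfold)
  moreover have "h ` L \<subseteq> (UNIV \<times> UNIV) \<times> {\<lfloor>lo\<rfloor>..\<lfloor>hi\<rfloor>}"
    using strip by (auto simp: h_def intro!: floor_mono)
  ultimately have "q summable_on h ` L" by (rule summable_on_subset_banach)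
  then have "(q \<circ> h) summable_on L" using summable_on_reindex[OF inj] by blast
  then have "(\<lambda>V. 2 powr \<beta> * (q \<circ> h) V) summable_on L" by (rule summable_on_cmult_right)
  then show ?thesis
  proof (rule summable_on_comparison_test)
    fix V assume "V \<in> L"
    then have V: "V \<in> SL2" using L by blast
    define n where "n = real_of_int (entry_sum V)"
    have n: "n \<ge> 1" using entry_sum_ge_1[OF V] by (simp add: n_def)
    have "(1 + \<bar>real_of_int (V$2$1)\<bar>) * (1 + \<bar>real_of_int (V$2$2)\<bar>) \<le> (2 * n) * (2 * n)"
      using n by (intro mult_mono) (auto simp: n_def entry_sum_def)
    then have "((2 * n) * (2 * n)) powr (- (\<beta> / 2)) \<le>
        ((1 + \<bar>real_of_int (V$2$1)\<bar>) * (1 + \<bar>real_of_int (V$2$2)\<bar>)) powr (- (\<beta> / 2))"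
      using \<beta> by (intro powr_mono2') (auto intro!: mult_pos_pos add_pos_nonneg)
    also have "\<dots> = (q \<circ> h) V"
      by (simp add: q_def h_def p_def powr_mult)
    finally have "((2 * n) * (2 * n)) powr (- (\<beta> / 2)) \<le> (q \<circ> h) V" .
    moreover have "((2 * n) * (2 * n)) powr (- (\<beta> / 2)) = 2 powr (- \<beta>) * n powr (- \<beta>)"
    proof -
      have "((2 * n) * (2 * n)) powr (- (\<beta> / 2)) = (2 * n) powr (- (\<beta> / 2) + - (\<beta> / 2))"
        using n by (subst powr_mult, subst powr_add) auto
      also have "- (\<beta> / 2) + - (\<beta> / 2) = - \<beta>" by simp
      finally show ?thesis using n by (simp add: powr_mult)
    qed
    ultimately have "2 powr (- \<beta>) * n powr (- \<beta>) \<le> (q \<circ> h) V" by simp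
    then have "2 powr \<beta> * (2 powr (- \<beta>) * n powr (- \<beta>)) \<le> 2 powr \<beta> * (q \<circ> h) V"
      by (intro mult_left_mono) auto
    then show "n powr (- \<beta>) \<le> 2 powr \<beta> * (q \<circ> h) V"
      by (simp add: powr_minus field_simps)
  qed auto
qed

text \<open>For \<open>z = \<i> * v\<^sub>0\<close> the images \<open>moeb V z\<close> stay in a
  bounded set: the real part by the choice of representatives, the imaginary part because
  \<open>\<bar>c * z + d\<bar>\<close> is bounded below. Hence the numerator
  \<open>a * z + b\<close>, and with it the top row, is controlled by the bottom row.\<close>

lemma coset_reps_entry_sum:
  fixes v\<^sub>0 l :: real
  assumes "v\<^sub>0 > 0"
  shows "\<exists>D>0. \<forall>V\<in>coset_reps \<Gamma> l v\<^sub>0 \<inter> SL2. real_of_int (entry_sum V) \<le> D * real_of_int (\<bar>V$2$1\<bar> + \<bar>V$2$2\<bar>)"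
proof -
  define z where "z = \<i> * complex_of_real v\<^sub>0"
  have z: "Im z = v\<^sub>0" "norm z = v\<^sub>0" "z \<in> uhp" using assms by (simp_all add: z_def norm_mult uhp_iff)
  define c where "c = row_const v\<^sub>0 v\<^sub>0"
  have c: "c > 0" unfolding c_def using assms by (intro row_const_pos) auto
  define m where "m = \<bar>l\<bar> + v\<^sub>0 * c\<^sup>2"
  have m: "m \<ge> 0" using assms by (simp add: m_def)
  define D where "D = 1 + c * (m * (1 + v\<^sub>0))"
  show ?thesis
  proof (intro exI[of _ D] conjI ballI)
    show "D > 0" using assms c m by (simp add: D_def add_pos_nonneg)
    fix V assume "V \<in> coset_reps \<Gamma> l v\<^sub>0 \<inter> SL2"
    then have V: "V \<in> SL2" "- l / 2 \<le> Re (moeb V z)" "Re (moeb V z) < l / 2"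
      by (auto simp: coset_reps_def z_def)
    define j where "j = norm (aut_factor V z)"
    have j0: "j > 0" using aut_factor_nonzero[OF V(1) z(3)] by (simp add: j_def)
    have "1 \<le> \<bar>V$2$1\<bar> + \<bar>V$2$2\<bar>" using SL2_row_nonzero[OF V(1), of 2] by linarith
    then have "1 \<le> real_of_int (\<bar>V$2$1\<bar> + \<bar>V$2$2\<bar>)" by linarith
    also have "\<dots> \<le> c * j"
      unfolding c_def j_def aut_factor_def using assms z by (intro row_sum_le_norm) auto
    finally have "1 \<le> (c * j)\<^sup>2" using one_le_power by blast
    then have "v\<^sub>0 / j\<^sup>2 \<le> v\<^sub>0 * c\<^sup>2"
      using j0 assms by (simp add: field_simps power_mult_distrib)
    then have im: "\<bar>Im (moeb V z)\<bar> \<le> v\<^sub>0 * c\<^sup>2"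
      using assms by (simp add: Im_moeb[OF V(1)] z(1) j_def)
    have "norm (moeb V z) \<le> \<bar>Re (moeb V z)\<bar> + \<bar>Im (moeb V z)\<bar>" by (rule cmod_le)
    also have "\<dots> \<le> m" using im V by (simp add: m_def)
    finally have moeb: "norm (moeb V z) \<le> m" .
    have "real_of_int (\<bar>V$1$1\<bar> + \<bar>V$1$2\<bar>) \<le> c * norm (of_int (V$1$1) * z + of_int (V$1$2))"
      unfolding c_def using assms z by (intro row_sum_le_norm) auto
    also have "norm (of_int (V$1$1) * z + of_int (V$1$2)) = norm (moeb V z) * j"
      using j0 by (simp add: moeb_def norm_divide j_def)
    also have "c * (norm (moeb V z) * j) \<le> c * (m * ((1 + v\<^sub>0) * real_of_int (\<bar>V$2$1\<bar> + \<bar>V$2$2\<bar>)))"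
      using moeb c j0 m norm_row_le[of z v\<^sub>0 "V$2$1" "V$2$2"] z
      by (intro mult_left_mono mult_mono) (auto simp: j_def aut_factor_def)
    finally show "real_of_int (entry_sum V) \<le> D * real_of_int (\<bar>V$2$1\<bar> + \<bar>V$2$2\<bar>)"
      by (simp add: D_def entry_sum_def algebra_simps)
  qed
qed

section \<open>Uniform convergence of vector-valued series\<close>

lemma uniform_limit_sum:
  fixes f :: "'i \<Rightarrow> 'a \<Rightarrow> 'b \<Rightarrow> 'c :: real_normed_vector"
  assumes "finite J" "\<And>j. j \<in> J \<Longrightarrow> uniform_limit C (f j) (h j) F"
  shows "uniform_limit C (\<lambda>x y. \<Sum>j\<in>J. f j x y) (\<lambda>y. \<Sum>j\<in>J. h j y) F"
  using assms by (induction J) (auto intro!: uniform_limit_add uniform_limit_const)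

lemma bounded_linear_vector_scalar_mult_axis:
  "bounded_linear (\<lambda>x :: complex. x *s (axis j 1 :: complex^'p))"
proof (rule bounded_linear_intro[where K = "norm (axis j 1 :: complex^'p)"])
  show "norm (x *s (axis j 1 :: complex^'p)) \<le> norm x * norm (axis j 1 :: complex^'p)" for x
    by (simp add: norm_vector_scalar_mult)
qed (simp_all add: vec_eq_iff algebra_simps)

theorem theorem3p6:
  fixes \<Gamma> :: "(int^2^2) set" and l :: int
    and t s :: nat and Qs Vs :: "nat \<Rightarrow> int^2^2"
    and k :: real and chi :: "int^2^2 \<Rightarrow> complex"
    and \<rho> :: "int^2^2 \<Rightarrow> complex^'p^'p"
    and g :: "int^2^2 \<Rightarrow> complex \<Rightarrow> complex^'p"
    and gs :: "nat \<Rightarrow> complex \<Rightarrow> complex^'p"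
    and K \<alpha> \<sigma> e v\<^sub>0 :: real and r :: nat
  assumes first_kind: "fuchsian_first_kind \<Gamma>"
    and parabolic_class: "\<exists>B\<in>\<Gamma>. parabolic B"
    and l_pos: "l > 0"
    and stab: "generates_mod_sign (translation l) (stab_inf \<Gamma>)"
    and gens: "generate SL2Z (Qs ` {0..t} \<union> Vs ` {1..s}) = \<Gamma>"
    and Q0: "Qs 0 = translation l"
    and Qs_parabolic: "\<forall>i\<in>{0..t}. parabolic (Qs i)"
    and Vs_nonparabolic: "\<forall>i\<in>{1..s}. Vs i \<in> carrier SL2Z \<and> \<not> parabolic (Vs i)"
    and chi: "multiplier_system \<Gamma> (- k) chi"
    and rho: "unitary_rep \<Gamma> \<rho>"
    and g: "parabolic_cocycle \<Gamma> k chi \<rho> g"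
    and g_Q: "\<forall>\<tau>\<in>uhp. g (translation l) \<tau> = 0"
    and gs: "\<forall>i\<in>{0..t}. gs i \<in> space_P \<and>
               (\<forall>\<tau>\<in>uhp. g (Qs i) \<tau> = slash k chi \<rho> (gs i) (Qs i) \<tau> - gs i \<tau>)"
    and consts_pos: "K > 0" "\<alpha> > 0" "\<sigma> > 0"
    and sigma: "2 * \<sigma> > - k"
    and alpha: "\<alpha> > k"
    and g_bound: "\<forall>i\<in>{1..s}. growth_bound K \<alpha> \<sigma> (g (Vs i))"
    and gs_bound: "\<forall>i\<in>{0..t}. growth_bound K \<alpha> \<sigma> (gs i)"
    and e: "e = max (\<alpha> / 2) (\<sigma> + k / 2)"
    and v0: "v\<^sub>0 > 0" "\<i> * of_real v\<^sub>0 \<in> fund_region \<Gamma> (of_int l)"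
    and r: "r > 0" "even r" "real r > 2 * e + 4"
  shows "(\<forall>\<tau>\<in>uhp. \<forall>j.
            (\<lambda>V. norm (Phi_term g r \<tau> j V)) summable_on coset_reps \<Gamma> (of_int l) v\<^sub>0) \<and>
         (\<forall>C. compact C \<and> C \<subseteq> uhp \<longrightarrow>
            uniform_limit C (Phi_partial g r) (\<lambda>\<tau>. Phi g (coset_reps \<Gamma> (of_int l) v\<^sub>0) \<tau> r)
              (finite_subsets_at_top (coset_reps \<Gamma> (of_int l) v\<^sub>0)))"
proof -
  define S where "S = Qs ` {0..t} \<union> Vs ` {1..s}"
  define E where "E = max \<alpha> (2 * \<sigma> + k)"
  define L where "L = coset_reps \<Gamma> (of_int l) v\<^sub>0"
  \<comment> \<open>The Weierstrass majorant: the cocycle grows with exponent \<open>E + 1\<close>,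
    and on compact sets the denominator contributes \<open>-r\<close>. Since
    \<open>E = 2 * e\<close>, the hypothesis on \<open>r\<close> makes \<open>r - E - 1\<close>
    exceed 2.\<close>
  define M where "M V = real_of_int (entry_sum V) powr (- (real r - E - 1))" for V
  have E2: "E = 2 * e" by (simp add: E_def e max_mult_distrib_left)
  have E0: "E \<ge> 0" using consts_pos by (simp add: E_def)
  have S_SL2: "S \<subseteq> SL2"
    using Qs_parabolic Vs_nonparabolic by (auto simp: S_def parabolic_def carrier_SL2Z)
  have \<Gamma>_SL2: "\<Gamma> \<subseteq> SL2"
    using group.generate_incl[OF group_SL2Z, of S] S_SL2 gens by (simp add: carrier_SL2Z S_def)
  have L: "L \<subseteq> \<Gamma>" by (auto simp: L_def coset_reps_def)
  have S_in: "S \<subseteq> \<Gamma>" unfolding gens[folded S_def, symmetric] by (auto intro: generate.incl)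
  have coc: "g (\<gamma>\<^sub>1 ** \<gamma>\<^sub>2) \<tau> = g \<gamma>\<^sub>2 \<tau> + slash k chi \<rho> (g \<gamma>\<^sub>1) \<gamma>\<^sub>2 \<tau>"
    if "\<gamma>\<^sub>1 \<in> \<Gamma>" "\<gamma>\<^sub>2 \<in> \<Gamma>" "\<tau> \<in> uhp" for \<gamma>\<^sub>1 \<gamma>\<^sub>2 \<tau>
    using g that by (simp add: parabolic_cocycle_def cocycle_def)
  have chi1: "norm (chi \<gamma>) = 1" if "\<gamma> \<in> \<Gamma>" for \<gamma>
    using chi that by (simp add: multiplier_system_def)
  have rho1: "\<rho> \<gamma> \<in> carrier unitary_group" if "\<gamma> \<in> \<Gamma>" for \<gamma>
    using rho that by (auto simp: unitary_rep_def hom_def)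
  have norm_slash: "norm (slash k chi \<rho> f \<gamma> \<tau>) = norm (aut_factor \<gamma> \<tau>) powr k * norm (f (moeb \<gamma> \<tau>))"
    if "\<gamma> \<in> \<Gamma>" for f \<gamma> \<tau>
    using norm_slash_unitary chi1[OF that] rho1[OF that] by blast
  have M_summable: "M summable_on L"
    unfolding M_def
  proof (rule summable_on_strip)
    show "L \<subseteq> SL2" using L \<Gamma>_SL2 by blast
    show "\<i> * of_real v\<^sub>0 \<in> uhp" using v0 by (simp add: uhp_iff)
    show "- of_int l / 2 \<le> Re (moeb V (\<i> * of_real v\<^sub>0))" "Re (moeb V (\<i> * of_real v\<^sub>0)) \<le> of_int l / 2"
      if "V \<in> L" for V using that by (auto simp: L_def coset_reps_def)
    show "real r - E - 1 > 2" using r E2 by simp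
  qed
  have bound: "\<exists>B. \<forall>V\<in>L. \<forall>\<tau>\<in>C. \<forall>j. norm (Phi_term g r \<tau> j V) \<le> B * M V"
    if C: "compact C" "C \<subseteq> uhp" for C
  proof -
    obtain \<delta> R where \<delta>R: "\<delta> > 0" "R \<ge> 0" "\<And>\<tau>. \<tau> \<in> C \<Longrightarrow> Im \<tau> \<ge> \<delta>" "\<And>\<tau>. \<tau> \<in> C \<Longrightarrow> norm \<tau> \<le> R"
      by (rule compact_uhp_bounds[OF C]) (rule that)
    have growth: "\<exists>B\<ge>0. \<forall>W\<in>\<Gamma>. \<forall>\<tau>\<in>C. norm (slash k chi \<rho> f W \<tau>) \<le> B * real_of_int (entry_sum W) powr E"
      if f: "growth_bound K \<alpha> \<sigma> f" for f
    proof -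
      obtain B where "B \<ge> 0" "\<And>W \<tau>. W \<in> SL2 \<Longrightarrow> Im \<tau> \<ge> \<delta> \<Longrightarrow> norm \<tau> \<le> R \<Longrightarrow>
          norm (aut_factor W \<tau>) powr k * norm (f (moeb W \<tau>)) \<le> B * real_of_int (entry_sum W) powr E"
        using slash_growth[OF f consts_pos sigma alpha \<delta>R(1,2) E_def] by blast
      then show ?thesis
        using \<delta>R(3,4) \<Gamma>_SL2 by (intro exI[of _ B]) (auto simp: norm_slash)
    qed
    interpret bounded_cocycle \<Gamma> S k chi \<rho> g C E
    proof
      fix f assume "f \<in> S"
      then consider i where "i \<in> {1..s}" "f = Vs i" | i where "i \<in> {0..t}" "f = Qs i"
        by (auto simp: S_def)
      then show "\<exists>B\<ge>0. \<forall>W\<in>\<Gamma>. \<forall>\<tau>\<in>C. norm (slash k chi \<rho> (g f) W \<tau>) \<le> B * real_of_int (entry_sum W) powr E"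
      proof cases
        case 1
        then show ?thesis using growth g_bound by blast
      next
        case 2
        \<comment> \<open>For a parabolic generator the growth hypothesis concerns
          \<open>gs i\<close>, not the cocycle. Its coboundary form gives, in norm, a bound of
          \<open>g f | W\<close> by \<open>gs i | (f ** W)\<close> and
          \<open>gs i | W\<close>.\<close>
        obtain B where B: "B \<ge> 0"
          "\<And>W \<tau>. W \<in> \<Gamma> \<Longrightarrow> \<tau> \<in> C \<Longrightarrow> norm (slash k chi \<rho> (gs i) W \<tau>) \<le> B * real_of_int (entry_sum W) powr E"
          using growth[of "gs i"] gs_bound 2 by blast
        have f: "f \<in> \<Gamma>" using \<open>f \<in> S\<close> S_in by blast
        define B' where "B' = B * real_of_int (entry_sum f) powr E + B"
        show ?thesis
        proof (intro exI[of _ B'] conjI ballI)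
          show "B' \<ge> 0" using B(1) by (simp add: B'_def)
          fix W \<tau> assume W: "W \<in> \<Gamma>" "\<tau> \<in> C"
          have \<tau>: "\<tau> \<in> uhp" and W2: "W \<in> SL2" using W C \<Gamma>_SL2 by auto
          have fW: "f ** W \<in> \<Gamma>"
            using generate.eng[of f SL2Z S W] f W gens by (simp add: S_def)
          have "g f (moeb W \<tau>) = slash k chi \<rho> (gs i) f (moeb W \<tau>) - gs i (moeb W \<tau>)"
            using gs 2 moeb_uhp[OF W2 \<tau>] by blast
          then have "norm (g f (moeb W \<tau>)) \<le> norm (slash k chi \<rho> (gs i) f (moeb W \<tau>)) + norm (gs i (moeb W \<tau>))"
            by (simp add: norm_triangle_ineq4)
          then have "norm (slash k chi \<rho> (g f) W \<tau>) \<le> norm (aut_factor W \<tau>) powr k *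
              (norm (slash k chi \<rho> (gs i) f (moeb W \<tau>)) + norm (gs i (moeb W \<tau>)))"
            by (simp add: norm_slash W mult_left_mono)
          also have "\<dots> = norm (slash k chi \<rho> (gs i) (f ** W) \<tau>) + norm (slash k chi \<rho> (gs i) W \<tau>)"
            using aut_factor_mult[OF W2 \<tau>, of f] moeb_mult[OF W2 \<tau>, of f]
            by (simp add: norm_slash W f fW norm_mult powr_mult algebra_simps)
          also have "\<dots> \<le> B * real_of_int (entry_sum (f ** W)) powr E + B * real_of_int (entry_sum W) powr E"
            using B W fW by (intro add_mono) auto
          also have "\<dots> \<le> B * (real_of_int (entry_sum f) powr E * real_of_int (entry_sum W) powr E)
              + B * real_of_int (entry_sum W) powr E"
            using B(1) entry_sum_mult_powr[OF E0] by (intro add_right_mono mult_left_mono)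
          finally show "norm (slash k chi \<rho> (g f) W \<tau>) \<le> B' * real_of_int (entry_sum W) powr E"
            by (simp add: B'_def algebra_simps)
        qed
      qed
    qed (rule gens[folded S_def] S_SL2 chi1 rho1 coc C(2) E0 | assumption | simp add: S_def)+
    obtain B where B: "B \<ge> 0"
      "\<And>V \<tau>. V \<in> \<Gamma> \<Longrightarrow> \<tau> \<in> C \<Longrightarrow> norm (g V \<tau>) \<le> B * real_of_int (entry_sum V) powr (E + 1)"
      using cocycle_growth by blast
    obtain D where D: "D > 0"
      "\<And>V. V \<in> L \<Longrightarrow> real_of_int (entry_sum V) \<le> D * real_of_int (\<bar>V$2$1\<bar> + \<bar>V$2$2\<bar>)"
      using coset_reps_entry_sum[OF v0(1), of \<Gamma> "of_int l"] L \<Gamma>_SL2 unfolding L_def by blast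
    \<comment> \<open>Chaining the two bounds compares the full entry sum with
      \<open>\<bar>c * \<tau> + d\<bar>\<close> for the coset representatives, so the denominator
      can be replaced by a power of the entry sum.\<close>
    define c where "c = D * row_const \<delta> R"
    have c: "c > 0" using D(1) row_const_pos[OF \<delta>R(1,2)] by (simp add: c_def)
    show ?thesis
    proof (intro exI[of _ "B * c ^ r"] ballI allI)
      fix V \<tau> j assume V: "V \<in> L" and \<tau>: "\<tau> \<in> C"
      define n where "n = real_of_int (entry_sum V)"
      define a where "a = norm (aut_factor V \<tau>)"
      have V2: "V \<in> \<Gamma>" "V \<in> SL2" using V L \<Gamma>_SL2 by auto
      have n: "n \<ge> 1" using entry_sum_ge_1[OF V2(2)] by (simp add: n_def)
      have "n \<le> D * real_of_int (\<bar>V$2$1\<bar> + \<bar>V$2$2\<bar>)" unfolding n_def by (rule D(2)[OF V])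
      also have "\<dots> \<le> D * (row_const \<delta> R * a)"
        unfolding a_def aut_factor_def using D(1) \<delta>R \<tau> by (intro mult_left_mono row_sum_le_norm) auto
      finally have "n \<le> c * a" by (simp add: c_def)
      then have npow: "n ^ r \<le> c ^ r * a ^ r" using n power_mono[of n "c * a" r] by (simp add: power_mult_distrib)
      have a0: "a > 0" using aut_factor_nonzero[OF V2(2)] \<tau> C by (auto simp: a_def)
      have "norm (Phi_term g r \<tau> j V) = norm (g V \<tau> $ j) / a ^ r"
        by (simp add: Phi_term_def norm_divide norm_power a_def)
      also have "\<dots> \<le> (B * n powr (E + 1)) / a ^ r"
        using order_trans[OF Finite_Cartesian_Product.norm_nth_le B(2)[OF V2(1) \<tau>]] a0 by (intro divide_right_mono) (auto simp: n_def)
      also have "\<dots> \<le> (B * n powr (E + 1)) * (c ^ r / n ^ r)"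
      proof -
        have "1 / a ^ r \<le> c ^ r / n ^ r" using npow a0 n by (simp add: field_simps)
        from mult_left_mono[OF this, of "B * n powr (E + 1)"] show ?thesis using B(1) by simp
      qed
      also have "\<dots> = B * c ^ r * (n powr (E + 1) / n powr (real r))"
        using n by (simp add: powr_realpow)
      also have "n powr (E + 1) / n powr (real r) = M V"
        unfolding M_def n_def[symmetric] powr_diff[symmetric] by (simp add: algebra_simps)
      finally show "norm (Phi_term g r \<tau> j V) \<le> B * c ^ r * M V" .
    qed
  qed
  have abs_summable: "(\<lambda>V. norm (Phi_term g r \<tau> j V)) summable_on L" if \<tau>: "\<tau> \<in> uhp" for \<tau> j
  proof -
    \<comment> \<open>Absolute convergence at a point is the case of the compact set consisting of
      that point.\<close>
    obtain B where B: "\<And>V. V \<in> L \<Longrightarrow> norm (Phi_term g r \<tau> j V) \<le> B * M V"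
      using bound[of "{\<tau>}"] \<tau> by auto
    show ?thesis
      using summable_on_cmult_right[OF M_summable] B by (rule Infinite_Sum.abs_summable_on_comparison_test')
  qed
  have uniform: "uniform_limit C (Phi_partial g r) (\<lambda>\<tau>. Phi g L \<tau> r) (finite_subsets_at_top L)"
    if C: "compact C" "C \<subseteq> uhp" for C
  proof -
    obtain B where B: "\<And>V \<tau> j. V \<in> L \<Longrightarrow> \<tau> \<in> C \<Longrightarrow> norm (Phi_term g r \<tau> j V) \<le> B * M V"
      using bound[OF C] by blast
    have "uniform_limit C (\<lambda>X \<tau>. \<Sum>V\<in>X. Phi_term g r \<tau> j V) (\<lambda>\<tau>. \<Sum>\<^sub>\<infinity>V\<in>L. Phi_term g r \<tau> j V)
        (finite_subsets_at_top L)" for j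
      using B summable_on_cmult_right[OF M_summable] by (rule Weierstrass_m_test_general)
    then have "uniform_limit C (\<lambda>X \<tau>. \<Sum>j\<in>UNIV. (\<Sum>V\<in>X. Phi_term g r \<tau> j V) *s axis j 1)
        (\<lambda>\<tau>. \<Sum>j\<in>UNIV. (\<Sum>\<^sub>\<infinity>V\<in>L. Phi_term g r \<tau> j V) *s axis j 1) (finite_subsets_at_top L)"
      by (intro uniform_limit_sum bounded_linear.uniform_limit[OF bounded_linear_vector_scalar_mult_axis]) auto
    then show ?thesis by (simp add: Phi_partial_def[abs_def] Phi_def)
  qed
  show ?thesis using abs_summable uniform by (simp add: L_def)
qed

end
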